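(* For a positive, $\sigma$-finite, locally finite Borel measure $\mu$ on the unit disk $\mathbb{D}$ with $\mu(\mathbb{D})=+\infty$, let $\Lambda_\mu$ be the Poisson point process on $\mathbb{D}$ with intensity $\mu$ and let $\mu_{n,k}=\mu(T_{n,k})$ for $n\ge 0$, $0\le k\le 2^n-1$. (a) For every such $\mu$, \[ \mathbb{P}\bigl(\Lambda_\mu\text{ is a 1-Carleson sequence}\bigr)= \begin{cases} 1 & \text{if there exists } \gamma>1 \text{ such that } \sum_{n,k}\mu_{n,k}^{\gamma}<\infty,\\ 0 & \text{if for all } \gamma>1,\ \sum_{n,k}\mu_{n,k}^{\gamma}=\infty. \end{cases} \] (b) Let $\alpha\in(0,1)$ and let $\mu$ be such a measure. If there exists $\gamma$ with $1<\gamma<\frac{1}{1-\alpha}$ and $\sum_{n,k}\mu_{n,k}^{\gamma}<+\infty$, then $\mathbb{P}(\Lambda_\mu\text{ is }\alpha\text{-Carleson})=1$. (c) For every $\alpha\in(0,1)$ there exists such a measure $\mu$ with $\sum_{n,k}\mu_{n,k}^{1/(1-\alpha)}<+\infty$ and $\mathbb{P}(\Lambda_\mu\text{ is }\alpha\text{-Carleson})=0$. (d) For every $\gamma>1$ there exists such a measure $\mu$ with $\sum_{n,k}\mu_{n,k}^{\gamma}=+\infty$ but $\mathbb{P}(\Lambda_\mu\text{ is }\alpha\text{-Carleson})=1$ for all $\alpha\in(0,1)$.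
   Context: $\mathbb{D}=\{z\in\mathbb{C}:|z|<1\}$, $\mathbb{T}=\partial\mathbb{D}$. The Poisson point process $\Lambda_\mu$ with intensity $\mu$ is the random sequence of points of $\mathbb{D}$ (unique in law) such that, writing $N_A=\#(A\cap\Lambda_\mu)$ (points counted with multiplicity): (a) for each Borel set $A\subset\mathbb{D}$, $N_A$ is a Poisson random variable of parameter $\mu(A)$; (b) $N_A$ and $N_B$ are independent for disjoint Borel sets $A,B$ (more generally, counting variables of pairwise disjoint Borel sets are independent). Locally finite means finite on compact subsets of $\mathbb{D}$. Dyadic boxes: for $n\ge 0$ and $k=0,1,\dots,2^n-1$, \[ T_{n,k}=\Bigl\{z=re^{it}\in\mathbb{D}: 2^{-(n+1)}<1-r\le 2^{-n},\ \tfrac{k}{2^n}\le\tfrac{t}{2\pi}<\tfrac{k+1}{2^n}\Bigr\}. \] Sums $\sum_{n,k}$ run over all $n\ge 0$ and $0\le k\le 2^n-1$. For an arc $I\subset\mathbb{T}$, $|I|$ is its normalized length ($|\mathbb{T}|=1$) and $Q(I)=\{z=re^{i\theta}\in\mathbb{D}: r>1-|I|,\ e^{i\theta}\in I\}$. For $\alpha\in(0,1]$, a sequence $\Lambda\subset\mathbb{D}$ is $\alpha$-Carleson if there is $C>0$ such that for all arcs $I\subset\mathbb{T}$, $\sum_{\lambda\in\Lambda\cap Q(I)}(1-|\lambda|)^\alpha\le C|I|^\alpha$ (points counted with multiplicity). *)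

theory Defs
  imports "HOL-Probability.Probability"
begin

abbreviation unit_disk :: "complex set" where
  "unit_disk \<equiv> ball 0 1"

definition intensity_measure :: "complex measure \<Rightarrow> bool" where
  "intensity_measure \<mu> \<longleftrightarrow>
     sets \<mu> = sets (restrict_space borel unit_disk) \<and>
     sigma_finite_measure \<mu> \<and>
     (\<forall>K. compact K \<and> K \<subseteq> unit_disk \<longrightarrow> emeasure \<mu> K < \<infinity>) \<and>
     emeasure \<mu> unit_disk = \<infinity>"


text \<open>Points are counted with multiplicity: the count is over the indices of the sequence.\<close>

definition num_points :: "(nat \<Rightarrow> complex) \<Rightarrow> complex set \<Rightarrow> ennreal" where
  "num_points zs A = emeasure (count_space UNIV) {i. zs i \<in> A}"

text \<open>Following the usual convention, a Poisson variable of parameter \<open>\<infinity>\<close> is almost surely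
  infinite. The library's \<open>poisson_pmf\<close> is specified for positive rates only; the explicit
  formula also covers parameter \<open>0\<close>, where it gives the point mass at \<open>0\<close> (as \<open>0 ^ 0 = 1\<close>).\<close>

definition poisson_variable :: "'w measure \<Rightarrow> ennreal \<Rightarrow> ('w \<Rightarrow> ennreal) \<Rightarrow> bool" where
  "poisson_variable M r X \<longleftrightarrow>
     X \<in> borel_measurable M \<and>
     (if r = \<infinity> then AE \<omega> in M. X \<omega> = \<infinity>
      else \<forall>k::nat. \<P>(\<omega> in M. X \<omega> = of_nat k) = enn2real r ^ k / fact k * exp (- enn2real r))"

text \<open>\<open>\<Lambda>\<close> realises the Poisson point process with intensity \<open>\<mu>\<close> on the probability space \<open>M\<close>, as a
  random sequence of points. Sequences indexed by all of \<open>nat\<close> suffice because the process has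
  almost surely infinitely many points when \<open>\<mu>\<close> has infinite total mass. Since some of the
  sets \<open>A i\<close> may be empty, the last condition includes finite families.\<close>

definition poisson_point_process ::
    "'w measure \<Rightarrow> complex measure \<Rightarrow> ('w \<Rightarrow> nat \<Rightarrow> complex) \<Rightarrow> bool" where
  "poisson_point_process M \<mu> \<Lambda> \<longleftrightarrow>
     prob_space M \<and>
     (\<forall>i. (\<lambda>\<omega>. \<Lambda> \<omega> i) \<in> measurable M \<mu>) \<and>
     (\<forall>A\<in>sets \<mu>. poisson_variable M (emeasure \<mu> A) (\<lambda>\<omega>. num_points (\<Lambda> \<omega>) A)) \<and>
     (\<forall>A :: nat \<Rightarrow> complex set. range A \<subseteq> sets \<mu> \<and> disjoint_family A \<longrightarrow>
        prob_space.indep_vars M (\<lambda>_. borel) (\<lambda>i \<omega>. num_points (\<Lambda> \<omega>) (A i)) UNIV)"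


definition dyadic_box :: "nat \<Rightarrow> nat \<Rightarrow> complex set" where
  "dyadic_box n k = {z. \<exists>r t. z = rcis r t \<and>
     1 / 2 ^ (n + 1) < 1 - r \<and> 1 - r \<le> 1 / 2 ^ n \<and>
     real k / 2 ^ n \<le> t / (2 * pi) \<and> t / (2 * pi) < real (k + 1) / 2 ^ n}"

text \<open>The boxes are relatively compact in the disk, so for an intensity measure the real-valued
  \<open>measure \<mu>\<close> agrees with \<open>emeasure \<mu>\<close> on them.\<close>

definition dyadic_sum :: "complex measure \<Rightarrow> real \<Rightarrow> ennreal" where
  "dyadic_sum \<mu> \<gamma> = (\<Sum>n. \<Sum>k<2 ^ n. ennreal (measure \<mu> (dyadic_box n k) powr \<gamma>))"


text \<open>Arcs may be open, half-open or closed, and may be the whole circle.\<close>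

definition is_circle_arc :: "complex set \<Rightarrow> bool" where
  "is_circle_arc I \<longleftrightarrow> (\<exists>J :: real set. is_interval J \<and> I = cis ` J)"

definition arc_length :: "complex set \<Rightarrow> real" where
  "arc_length I = measure lborel {t \<in> {0..<2 * pi}. cis t \<in> I} / (2 * pi)"

definition carleson_box :: "complex set \<Rightarrow> complex set" where
  "carleson_box I = {z. \<exists>r t. z = rcis r t \<and> 1 - arc_length I < r \<and> r < 1 \<and> cis t \<in> I}"

definition carleson_sequence :: "real \<Rightarrow> (nat \<Rightarrow> complex) \<Rightarrow> bool" where
  "carleson_sequence \<alpha> zs \<longleftrightarrow> (\<exists>C>0. \<forall>I. is_circle_arc I \<longrightarrow>
     (\<Sum>i. indicator (carleson_box I) (zs i) * ennreal ((1 - norm (zs i)) powr \<alpha>))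
       \<le> ennreal (C * arc_length I powr \<alpha>))"

text \<open>The first conjunct rules out that a probability is \<open>0\<close> merely because \<open>measure\<close> returns
  \<open>0\<close> on non-measurable sets.\<close>

definition carleson_with_prob ::
    "'w measure \<Rightarrow> ('w \<Rightarrow> nat \<Rightarrow> complex) \<Rightarrow> real \<Rightarrow> real \<Rightarrow> bool" where
  "carleson_with_prob M \<Lambda> \<alpha> p \<longleftrightarrow>
     {\<omega> \<in> space M. carleson_sequence \<alpha> (\<Lambda> \<omega>)} \<in> sets M \<and>
     \<P>(\<omega> in M. carleson_sequence \<alpha> (\<Lambda> \<omega>)) = p"

end

theory Submission
  imports Defs
begin

text \<open>
  The Carleson condition only has to be tested on dyadic arcs, where the sum over the Carleson box
  of the dyadic arc \<open>(n, k)\<close> is comparable to \<open>2 ^ (- n \<alpha>) X\<close>, with \<open>X\<close> the sum of the independent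
  Poisson counts of the dyadic boxes below \<open>(n, k)\<close>, each weighted by \<open>2 ^ (- l \<alpha>)\<close> for relative
  depth \<open>l\<close>. A Chernoff bound gives \<open>P (X > p) \<le> e \<epsilon> ^ p\<close> for \<open>\<epsilon> = E X\<close>, and by Hoelder's inequality
  \<open>\<epsilon> ^ \<gamma>\<close> is at most a sum of the \<open>\<mu>\<close>-values of the boxes to the power \<open>\<gamma>\<close>, geometrically damped in
  the depth exactly when \<open>\<gamma> (1 - \<alpha>) < 1\<close>; Borel--Cantelli with \<open>p = \<gamma>\<close> then yields the positive results.
  Conversely, if every sum of powers diverges, then by independence for each \<open>K\<close> some box contains at
  least \<open>K\<close> points, which contradicts the 1-Carleson condition.

  Both examples put point masses in the dyadic boxes. For (c) all boxes of generation \<open>n\<close> receive mass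
  \<open>2 ^ (- n (1 - \<alpha>)) / (n + 1)\<close>, so that the mean of \<open>X\<close> over the whole disk is harmonic and \<open>X = \<infinity>\<close>
  almost surely. For (d) only the boxes \<open>(n, 0)\<close> receive mass, namely \<open>(n + 1) ^ (- 1 / \<gamma>)\<close>.
\<close>

section \<open>Dyadic boxes and the dyadic Carleson condition\<close>

text \<open>Hoelder's inequality is applied after splitting the depth weight 2 ^ (- l \<alpha>) into
  2 ^ (- l \<tau>) and 2 ^ (- l (\<alpha> - \<tau>)). A box has 2 ^ l descendants at depth l, so the
  q-th powers of the first factor sum to a bounded quantity only if \<tau> > 1 / q, where q is
  conjugate to \<gamma>; the second factor damps only if \<tau> < \<alpha>. There is room between
  the two exactly when 1 - 1 / \<gamma> < \<alpha>. At the critical exponent 1 / (1 - \<alpha>) the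
  room is gone, and in (c) the factor 1 / (n + 1) is small enough for the sum of powers but too
  large for the mean. In the Chernoff bound the threshold p equals the power of \<epsilon> because
  the exponential parameter is taken to be - ln \<epsilon>. Any p > 0 is admissible, which is why
  (d) can succeed with p = 2 \<gamma> although the sum of \<gamma>-th powers diverges.
  Borel-Cantelli controls all but finitely many generations. The boxes left over only need almost
  surely finite weighted counts, since the Carleson constant may depend on the outcome.\<close>

definition turn :: "complex \<Rightarrow> real" where
  "turn z = Arg2pi z / (2 * pi)"

lemma turn_0 [simp]: "turn 0 = 0"
  by (simp add: turn_def)

lemma turn_nonneg: "0 \<le> turn z" and turn_less_1: "turn z < 1"
  using Arg2pi[of z] by (auto simp: turn_def field_simps)

lemma rcis_turn: "z = rcis (norm z) (2 * pi * turn z)"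
  using Arg2pi[of z] by (simp add: turn_def is_Arg_def rcis_def cis_conv_exp)

lemma cis_frac: "cis (2 * pi * frac (t / (2 * pi))) = cis t"
proof -
  have "cis (2 * pi * frac (t / (2 * pi))) = cis (t - 2 * pi * of_int \<lfloor>t / (2 * pi)\<rfloor>)"
    by (simp add: frac_def algebra_simps)
  also have "\<dots> = cis t"
    using cis_multiple_2pi[of "of_int \<lfloor>t / (2 * pi)\<rfloor>"] by (simp flip: cis_divide)
  finally show ?thesis .
qed

lemma turn_rcis: "0 < r \<Longrightarrow> turn (rcis r t) = frac (t / (2 * pi))"
proof -
  assume r: "0 < r"
  have "Arg2pi (rcis r t) = 2 * pi * frac (t / (2 * pi))"
  proof (rule Arg2pi_unique[of r])
    show "of_real r * exp (\<i> * of_real (2 * pi * frac (t / (2 * pi)))) = rcis r t"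
      using cis_frac[of t] by (simp only: rcis_def flip: cis_conv_exp)
  qed (use r frac_lt_1[of "t / (2 * pi)"] in auto)
  then show ?thesis by (simp add: turn_def)
qed

text \<open>\<open>Arg2pi\<close> jumps across the positive real axis, but its sublevel sets are
  still closed, and that suffices.\<close>

lemma borel_measurable_turn [measurable]: "turn \<in> borel_measurable borel"
proof -
  have "Arg2pi \<in> borel_measurable borel"
    by (rule borel_measurableI_le) (simp add: closed_Arg2pi2pi_le)
  then show ?thesis unfolding turn_def by measurable
qed

lemma floor_turn_eq_iff:
  "\<lfloor>2 ^ n * turn z\<rfloor> = int k \<longleftrightarrow> real k / 2 ^ n \<le> turn z \<and> turn z < real (k + 1) / 2 ^ n"
  by (auto simp: floor_eq_iff field_simps)

lemma nat_floor_turn: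
  "nat \<lfloor>2 ^ n * turn z\<rfloor> < 2 ^ n" "int (nat \<lfloor>2 ^ n * turn z\<rfloor>) = \<lfloor>2 ^ n * turn z\<rfloor>"
proof -
  have "2 ^ n * turn z < 2 ^ n" "0 \<le> 2 ^ n * turn z"
    using turn_less_1[of z] turn_nonneg[of z] by auto
  then show "int (nat \<lfloor>2 ^ n * turn z\<rfloor>) = \<lfloor>2 ^ n * turn z\<rfloor>" "nat \<lfloor>2 ^ n * turn z\<rfloor> < 2 ^ n"
    by (auto simp: nat_less_iff floor_less_iff)
qed

lemma dyadic_right_endpoint_le_1: "k < 2 ^ n \<Longrightarrow> real (k + 1) / 2 ^ n \<le> 1"
  by (metis Suc_eq_plus1 Suc_leI divide_le_eq_1_pos of_nat_le_iff of_nat_numeral of_nat_power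
      zero_less_numeral zero_less_power)

text \<open>As k < 2 ^ n, the angle in the definition already lies in [0, 1) turns, so it is
  \<open>turn z\<close> and the existential quantifiers disappear. In the floor form, measurability
  and the passage between generations are immediate.\<close>

lemma dyadic_box_iff:
  assumes "k < 2 ^ n"
  shows "z \<in> dyadic_box n k \<longleftrightarrow>
    1 / 2 ^ (n + 1) < 1 - norm z \<and> 1 - norm z \<le> 1 / 2 ^ n \<and> \<lfloor>2 ^ n * turn z\<rfloor> = int k"
proof
  assume "z \<in> dyadic_box n k"
  then obtain r t where z: "z = rcis r t" and r: "1 / 2 ^ (n + 1) < 1 - r" "1 - r \<le> 1 / 2 ^ n"
    and t: "real k / 2 ^ n \<le> t / (2 * pi)" "t / (2 * pi) < real (k + 1) / 2 ^ n"
    unfolding dyadic_box_def by blast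
  have "1 / 2 ^ n \<le> (1::real)" by simp
  with r have r0: "0 \<le> r" by linarith
  then have nz: "norm z = r" using z by simp
  show "1 / 2 ^ (n + 1) < 1 - norm z \<and> 1 - norm z \<le> 1 / 2 ^ n \<and> \<lfloor>2 ^ n * turn z\<rfloor> = int k"
  \<comment> \<open>The angle of the origin is arbitrary, but r = 0 forces n = 0 and hence k = 0, in
    agreement with the convention \<open>turn 0 = 0\<close>.\<close>
  proof (cases "r = 0")
    case True
    then have "(2::real) ^ n \<le> 1" using r by (simp add: field_simps)
    then have "n = 0" by (metis not_less one_less_numeral_iff one_less_power semiring_norm(76) zero_less_iff_neq_zero)
    with True r nz assms z show ?thesis by auto
  next
    case False
    have "real (k + 1) / 2 ^ n \<le> 1" by (rule dyadic_right_endpoint_le_1[OF assms])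
    moreover have "0 \<le> real k / 2 ^ n" by simp
    ultimately have "0 \<le> t / (2 * pi)" "t / (2 * pi) < 1" using t by linarith+
    then have "turn z = t / (2 * pi)" using z r0 False by (simp add: turn_rcis frac_eq)
    then show ?thesis using t r nz unfolding floor_turn_eq_iff by simp
  qed
next
  assume "1 / 2 ^ (n + 1) < 1 - norm z \<and> 1 - norm z \<le> 1 / 2 ^ n \<and> \<lfloor>2 ^ n * turn z\<rfloor> = int k"
  then show "z \<in> dyadic_box n k"
    unfolding dyadic_box_def floor_turn_eq_iff
    by (intro CollectI exI[of _ "norm z"] exI[of _ "2 * pi * turn z"]) (simp flip: rcis_turn)
qed

lemma dyadic_box_borel: "k < 2 ^ n \<Longrightarrow> dyadic_box n k \<in> sets borel"
proof -
  assume k: "k < 2 ^ n"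
  have "dyadic_box n k = {z. 1 / 2 ^ (n + 1) < 1 - norm z \<and> 1 - norm z \<le> 1 / 2 ^ n \<and>
      \<lfloor>2 ^ n * turn z\<rfloor> = int k}"
    using dyadic_box_iff[OF k] by auto
  also have "\<dots> \<in> sets borel" by measurable
  finally show ?thesis .
qed

lemma dyadic_box_subset_cball: "k < 2 ^ n \<Longrightarrow> dyadic_box n k \<subseteq> cball 0 (1 - 1 / 2 ^ (n + 1))"
  unfolding subset_iff dyadic_box_iff by simp

lemma dyadic_box_subset_disk: "k < 2 ^ n \<Longrightarrow> dyadic_box n k \<subseteq> unit_disk"
proof
  fix z assume "k < 2 ^ n" "z \<in> dyadic_box n k"
  then have "1 / 2 ^ (n + 1) < 1 - norm z" by (simp add: dyadic_box_iff)
  moreover have "0 < (1::real) / 2 ^ (n + 1)" by simp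
  ultimately have "norm z < 1" by linarith
  then show "z \<in> unit_disk" by simp
qed

lemma ex_dyadic_level:
  assumes "0 < x" "x \<le> (1::real)"
  shows "\<exists>n. 1 / 2 ^ (n + 1) < x \<and> x \<le> 1 / 2 ^ n"
proof -
  obtain m where "(1 / 2) ^ m < x" using real_arch_pow_inv[of x "1/2"] assms by auto
  then have ex: "\<exists>m. 1 / 2 ^ m < x" by (auto simp: power_one_over)
  define m where "m = (LEAST m. 1 / 2 ^ m < x)"
  have m: "1 / 2 ^ m < x" unfolding m_def using ex by (rule LeastI_ex)
  have "m \<noteq> 0" using m assms by (intro notI) auto
  then obtain n where n: "m = Suc n" by (cases m) auto
  have "\<not> 1 / 2 ^ n < x" using not_less_Least[of n "\<lambda>m. 1 / 2 ^ m < x"] n unfolding m_def by auto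
  then show ?thesis using m n by (intro exI[of _ n]) auto
qed

lemma level_unique:
  fixes x :: real
  assumes "1 / 2 ^ (n + 1) < x" "x \<le> 1 / 2 ^ n" "1 / 2 ^ (m + 1) < x" "x \<le> 1 / 2 ^ m"
  shows "n = m"
proof -
  have *: "n \<le> m" if "1 / 2 ^ (n + 1) < x" "x \<le> 1 / 2 ^ n" "1 / 2 ^ (m + 1) < x" "x \<le> 1 / 2 ^ m" for n m :: nat
  proof (rule ccontr)
    assume "\<not> n \<le> m"
    then have "(2::real) ^ (m + 1) \<le> 2 ^ n" by (intro power_increasing) auto
    then have "1 / 2 ^ n \<le> (1::real) / 2 ^ (m + 1)" by (intro divide_left_mono) auto
    with that show False by linarith
  qed
  from *[of n m] *[of m n] assms show ?thesis by auto
qed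

lemma dyadic_box_unique:
  assumes "z \<in> dyadic_box n k" "z \<in> dyadic_box m j" "k < 2 ^ n" "j < 2 ^ m"
  shows "n = m \<and> k = j"
  using assms level_unique[of n "1 - norm z" m] by (auto simp: dyadic_box_iff)

section \<open>Dyadic arcs and the covering of arbitrary arcs by them\<close>

definition dyadic_arc :: "nat \<Rightarrow> nat \<Rightarrow> complex set" where
  "dyadic_arc n k = cis ` {2 * pi * (real k / 2 ^ n) ..< 2 * pi * (real (k + 1) / 2 ^ n)}"

lemma is_circle_arc_dyadic_arc: "is_circle_arc (dyadic_arc n k)"
  unfolding is_circle_arc_def dyadic_arc_def
  by (intro exI[of _ "{2 * pi * (real k / 2 ^ n) ..< 2 * pi * (real (k + 1) / 2 ^ n)}"] conjI)
     (simp_all only: is_interval_co)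

lemma cis_in_dyadic_arc_iff:
  assumes "k < 2 ^ n"
  shows "cis t \<in> dyadic_arc n k \<longleftrightarrow> \<lfloor>2 ^ n * frac (t / (2 * pi))\<rfloor> = int k"
proof
  have le1: "real (k + 1) / 2 ^ n \<le> 1" by (rule dyadic_right_endpoint_le_1[OF assms])
  have T: "turn (cis t) = frac (t / (2 * pi))" for t using turn_rcis[of 1 t] by (simp add: rcis_def)
  {
    assume "cis t \<in> dyadic_arc n k"
    then obtain s where s: "cis t = cis s" "2 * pi * (real k / 2 ^ n) \<le> s" "s < 2 * pi * (real (k + 1) / 2 ^ n)"
      by (auto simp: dyadic_arc_def)
    have s': "real k / 2 ^ n \<le> s / (2 * pi)" "s / (2 * pi) < real (k + 1) / 2 ^ n"
      using s by (auto simp: field_simps)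
    moreover have "0 \<le> real k / 2 ^ n" by simp
    ultimately have "frac (s / (2 * pi)) = s / (2 * pi)" using le1 by (subst frac_eq) linarith
    then have "turn (cis t) = s / (2 * pi)" using s(1) T by simp
    then show "\<lfloor>2 ^ n * frac (t / (2 * pi))\<rfloor> = int k"
      using s' floor_turn_eq_iff[of n "cis t" k] T by simp
  }
  {
    assume "\<lfloor>2 ^ n * frac (t / (2 * pi))\<rfloor> = int k"
    then have "real k / 2 ^ n \<le> frac (t / (2 * pi)) \<and> frac (t / (2 * pi)) < real (k + 1) / 2 ^ n"
      using floor_turn_eq_iff[of n "cis t" k] T by simp
    then have "2 * pi * frac (t / (2 * pi)) \<in> {2 * pi * (real k / 2 ^ n) ..< 2 * pi * (real (k + 1) / 2 ^ n)}"
      unfolding atLeastLessThan_iff by (intro conjI mult_left_mono mult_strict_left_mono) auto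
    then show "cis t \<in> dyadic_arc n k" unfolding dyadic_arc_def by (metis cis_frac image_eqI)
  }
qed

lemma arc_length_dyadic_arc:
  assumes "k < 2 ^ n"
  shows "arc_length (dyadic_arc n k) = 1 / 2 ^ n"
proof -
  have le1: "real (k + 1) / 2 ^ n \<le> 1" by (rule dyadic_right_endpoint_le_1[OF assms])
  have le2: "2 * pi * (real (k + 1) / 2 ^ n) \<le> 2 * pi"
    using mult_left_mono[OF le1, of "2 * pi"] by simp
  have "{t \<in> {0..<2 * pi}. cis t \<in> dyadic_arc n k} =
      {2 * pi * (real k / 2 ^ n) ..< 2 * pi * (real (k + 1) / 2 ^ n)}" (is "?A = ?B")
  proof (intro set_eqI iffI)
    fix t assume t: "t \<in> ?A"
    then have "frac (t / (2 * pi)) = t / (2 * pi)" by (subst frac_eq) auto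
    then have "\<lfloor>2 ^ n * (t / (2 * pi))\<rfloor> = int k" using t cis_in_dyadic_arc_iff[OF assms, of t] by simp
    then show "t \<in> ?B" by (auto simp: floor_eq_iff field_simps)
  next
    fix t assume t: "t \<in> ?B"
    moreover have "0 \<le> 2 * pi * (real k / 2 ^ n)" by simp
    ultimately have "0 \<le> t" "t < 2 * pi" using le2 unfolding atLeastLessThan_iff by linarith+
    with t show "t \<in> ?A" by (auto simp: dyadic_arc_def)
  qed
  then have "arc_length (dyadic_arc n k) = (2 * pi * (real (k + 1) / 2 ^ n) - 2 * pi * (real k / 2 ^ n)) / (2 * pi)"
    unfolding arc_length_def by (simp add: divide_right_mono mult_left_mono)
  also have "\<dots> = 1 / 2 ^ n" by (simp add: field_simps)
  finally show ?thesis .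
qed

lemma arc_length_le_1: "arc_length I \<le> 1"
proof -
  have "measure lborel {t \<in> {0..<2 * pi}. cis t \<in> I} \<le> 2 * pi"
  proof (cases "{t \<in> {0..<2 * pi}. cis t \<in> I} \<in> sets lborel")
    case True
    then have "measure lborel {t \<in> {0..<2 * pi}. cis t \<in> I} \<le> measure lborel {0..<2 * pi}"
      by (intro measure_mono_fmeasurable) (auto simp: fmeasurable_def)
    then show ?thesis by simp
  qed (simp add: measure_notin_sets)
  then show ?thesis by (simp add: arc_length_def)
qed

text \<open>The strict inequality r > 1 - 1 / 2 ^ n keeps the origin out, so r is the modulus and
  the angle is determined up to full turns.\<close>

lemma carleson_box_dyadic_iff:
  assumes "k < 2 ^ n"
  shows "z \<in> carleson_box (dyadic_arc n k) \<longleftrightarrow>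
    1 - 1 / 2 ^ n < norm z \<and> norm z < 1 \<and> \<lfloor>2 ^ n * turn z\<rfloor> = int k"
proof
  assume "z \<in> carleson_box (dyadic_arc n k)"
  then obtain r t where z: "z = rcis r t" "1 - 1 / 2 ^ n < r" "r < 1" "cis t \<in> dyadic_arc n k"
    unfolding carleson_box_def arc_length_dyadic_arc[OF assms] by auto
  have "1 / 2 ^ n \<le> (1::real)" by simp
  with z have "0 < r" by linarith
  with z show "1 - 1 / 2 ^ n < norm z \<and> norm z < 1 \<and> \<lfloor>2 ^ n * turn z\<rfloor> = int k"
    by (simp add: turn_rcis cis_in_dyadic_arc_iff[OF assms])
next
  assume *: "1 - 1 / 2 ^ n < norm z \<and> norm z < 1 \<and> \<lfloor>2 ^ n * turn z\<rfloor> = int k"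
  have "frac (turn z) = turn z" using turn_nonneg turn_less_1 by (simp add: frac_eq)
  then have "cis (2 * pi * turn z) \<in> dyadic_arc n k"
    unfolding cis_in_dyadic_arc_iff[OF assms] using * by simp
  then show "z \<in> carleson_box (dyadic_arc n k)"
    unfolding carleson_box_def arc_length_dyadic_arc[OF assms] using *
    by (intro CollectI exI[of _ "norm z"] exI[of _ "2 * pi * turn z"]) (simp flip: rcis_turn)
qed

lemma carleson_box_dyadic_borel:
  assumes "k < 2 ^ n"
  shows "carleson_box (dyadic_arc n k) \<in> sets borel"
proof -
  have "carleson_box (dyadic_arc n k) =
      {z. 1 - 1 / 2 ^ n < norm z \<and> norm z < 1 \<and> \<lfloor>2 ^ n * turn z\<rfloor> = int k}"
    using carleson_box_dyadic_iff[OF assms] by auto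
  also have "\<dots> \<in> sets borel" by measurable
  finally show ?thesis .
qed

text \<open>\<open>arc_length\<close> is read off in the window [0, 2 pi), so the segment from a to
  b is translated by a multiple of 2 pi until it starts there. Being no longer than 2 pi, it leaves
  the window at most once, and the overhang reappears at the left end.\<close>

lemma arc_width_le:
  assumes J: "is_interval J" and ab: "a \<in> J" "b \<in> J" "a \<le> b" "b - a \<le> 2 * pi"
  shows "(b - a) / (2 * pi) \<le> arc_length (cis ` J)"
proof -
  define p where "p = 2 * pi"
  have p: "p > 0" by (simp add: p_def)
  define f where "f = 2 * pi * of_int \<lfloor>a / (2 * pi)\<rfloor>"
  define a' where "a' = a - f"
  define b' where "b' = b - f"
  have cf: "cis (t + f) = cis t" for t
    using cis_multiple_2pi[of "of_int \<lfloor>a / (2 * pi)\<rfloor>"] by (simp add: f_def flip: cis_mult)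
  have sub: "{a..b} \<subseteq> J" using mem_is_interval_1_I[OF J ab(1,2)] by auto
  have a': "0 \<le> a'" "a' < p"
  proof -
    have "a' = 2 * pi * frac (a / (2 * pi))" by (simp add: a'_def f_def frac_def algebra_simps)
    then show "0 \<le> a'" "a' < p" using frac_lt_1[of "a / (2 * pi)"] by (auto simp: p_def)
  qed
  have in1: "cis t \<in> cis ` J" if "a' \<le> t" "t \<le> b'" for t
  proof -
    have "t + f \<in> J" using sub that by (auto simp: a'_def b'_def)
    then show ?thesis by (metis cf image_eqI)
  qed
  have in2: "cis t \<in> cis ` J" if "t \<le> b' - p" "0 \<le> t" for t
  proof -
    have "cis (t + p) = cis t" by (simp add: p_def flip: cis_mult)
    moreover have "cis (t + p) \<in> cis ` J" using that a' by (intro in1) auto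
    ultimately show ?thesis by simp
  qed
  define A where "A = {t \<in> {0..<2 * pi}. cis t \<in> cis ` J}"
  \<comment> \<open>Monotonicity of \<open>measure\<close> needs this: within the window, A is a
    countable union of translates of the interval J.\<close>
  have Am: "A \<in> fmeasurable lborel"
  proof -
    have "A = {0..<2 * pi} \<inter> (\<Union>m::int. (\<lambda>t. t + 2 * pi * of_int m) -` J)"
    proof (intro set_eqI iffI)
      fix t assume "t \<in> A"
      then obtain s where "t \<in> {0..<2 * pi}" and s: "s \<in> J" "cis t = cis s" by (auto simp: A_def)
      from s(2) obtain m :: int where "s = t + 2 * pi * of_int m"
        using sin_cos_eq_iff[of s t] by (metis cis.sel(1) cis.sel(2))
      with s \<open>t \<in> {0..<2 * pi}\<close> show "t \<in> {0..<2 * pi} \<inter> (\<Union>m::int. (\<lambda>t. t + 2 * pi * of_int m) -` J)"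
        by blast
    next
      fix t assume t: "t \<in> {0..<2 * pi} \<inter> (\<Union>m::int. (\<lambda>t. t + 2 * pi * of_int m) -` J)"
      then obtain m :: int where "t + 2 * pi * of_int m \<in> J" by blast
      moreover have "cis (t + 2 * pi * of_int m) = cis t"
        by (simp flip: cis_mult)
      ultimately show "t \<in> A" using t unfolding A_def by (metis (mono_tags, lifting) IntD1 image_eqI mem_Collect_eq)
    qed
    moreover have "(\<lambda>t. t + 2 * pi * of_int m) -` J \<in> sets borel" for m :: int
      using measurable_sets[of "\<lambda>t. t + 2 * pi * of_int m" borel borel J] real_interval_borel_measurable[OF J]
      by simp
    ultimately have "A \<in> sets lborel" by auto
    moreover have "emeasure lborel A \<le> emeasure lborel {0..<2 * pi}"
      by (intro emeasure_mono) (auto simp: A_def)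
    ultimately show ?thesis by (auto simp: fmeasurable_def intro: le_less_trans)
  qed
  \<comment> \<open>The part inside the window and the wrapped overhang; b - a \<le> 2 pi gives b' -
    p \<le> a', so the two do not overlap.\<close>
  define B where "B = {a'..<min b' p} \<union> {0..<b' - p}"
  have "B \<subseteq> A" unfolding B_def A_def using in1 in2 a' ab p by (auto simp: a'_def b'_def p_def)
  have mB: "measure lborel B = b - a"
  proof (cases "b' \<le> p")
    case True
    then have "B = {a'..<b'}" by (auto simp: B_def)
    then show ?thesis using ab by (simp add: a'_def b'_def)
  next
    case False
    then have "measure lborel B = (p - a') + (b' - p)"
      unfolding B_def using a' ab by (subst measure_Union) (auto simp: a'_def b'_def p_def)
    then show ?thesis by (simp add: a'_def b'_def)
  qed
  have "measure lborel B \<le> measure lborel A"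
    using \<open>B \<subseteq> A\<close> Am by (intro measure_mono_fmeasurable) (auto simp: B_def)
  then show ?thesis unfolding mB arc_length_def A_def[symmetric] by (simp add: divide_right_mono)
qed

text \<open>Two parameters more than 2 pi apart would put a full turn into J and force the length to
  be 1.\<close>

lemma arc_spread_le:
  assumes J: "is_interval J" and ab: "a \<in> J" "b \<in> J" and l: "arc_length (cis ` J) < 1"
  shows "\<bar>b - a\<bar> / (2 * pi) \<le> arc_length (cis ` J)"
proof -
  have *: "(b - a) / (2 * pi) \<le> arc_length (cis ` J)" if ab: "a \<in> J" "b \<in> J" "a \<le> b" for a b
  proof (cases "b - a \<le> 2 * pi")
    case True
    then show ?thesis by (rule arc_width_le[OF J ab])
  next
    case False
    then have "a + 2 * pi \<in> J" using mem_is_interval_1_I[OF J ab(1,2), of "a + 2 * pi"] by simp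
    then have "(a + 2 * pi - a) / (2 * pi) \<le> arc_length (cis ` J)"
      using ab by (intro arc_width_le[OF J]) auto
    with l show ?thesis by simp
  qed
  show ?thesis using *[of a b] *[of b a] ab by (cases "a \<le> b") (auto simp: abs_if)
qed

lemma floor_turn_cis:
  "\<lfloor>2 ^ n * turn (cis t)\<rfloor> = \<lfloor>2 ^ n * (t / (2 * pi))\<rfloor> mod 2 ^ n"
proof -
  define x where "x = t / (2 * pi)"
  have T: "turn (cis t) = frac x" using turn_rcis[of 1 t] by (simp add: rcis_def x_def)
  have "2 ^ n * frac x = 2 ^ n * x - of_int (2 ^ n * \<lfloor>x\<rfloor>)" by (simp add: frac_def algebra_simps)
  then have "\<lfloor>2 ^ n * frac x\<rfloor> = \<lfloor>2 ^ n * x\<rfloor> - 2 ^ n * \<lfloor>x\<rfloor>" by (simp only: floor_diff_of_int)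
  then have "\<lfloor>2 ^ n * frac x\<rfloor> mod 2 ^ n = \<lfloor>2 ^ n * x\<rfloor> mod 2 ^ n"
    by (simp add: mod_diff_right_eq[symmetric])
  moreover have "\<lfloor>2 ^ n * frac x\<rfloor> mod 2 ^ n = \<lfloor>2 ^ n * frac x\<rfloor>"
    using nat_floor_turn[of n "cis t"] unfolding T by (intro mod_pos_pos_trivial) (auto simp: nat_less_iff)
  ultimately show ?thesis by (simp add: T x_def)
qed

lemma turn_rcis_cis: "0 < r \<Longrightarrow> turn (rcis r t) = turn (cis t)"
  using turn_rcis[of r t] turn_rcis[of 1 t] by (simp add: rcis_def)

text \<open>Relative to a fixed parameter a of the arc, every other one is at most 1 / 2 ^ n turns
  away, so its floor index differs by at most 1 and three adjacent dyadic arcs suffice. Generation 0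
  is separate because \<open>arc_spread_le\<close> says nothing about arcs of full length.\<close>

lemma carleson_box_cover:
  assumes I: "is_circle_arc I" and l: "arc_length I \<le> 1 / 2 ^ n"
  shows "\<exists>K. K \<subseteq> {..<2 ^ n} \<and> card K \<le> 3 \<and> carleson_box I \<subseteq> (\<Union>k\<in>K. carleson_box (dyadic_arc n k))"
proof -
  obtain J where J: "is_interval J" "I = cis ` J" using I by (auto simp: is_circle_arc_def)
  have box: "0 < r" "1 - 1 / 2 ^ n < r" if "1 - arc_length I < r" for r
  proof -
    show "1 - 1 / 2 ^ n < r" using that l by linarith
    show "0 < r" using that arc_length_le_1[of I] by linarith
  qed
  show ?thesis
  proof (cases "n = 0 \<or> J = {}")
    case True
    then show ?thesis
    proof
      assume n: "n = 0"
      show ?thesis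
      proof (intro exI[of _ "{0}"] conjI)
        show "carleson_box I \<subseteq> (\<Union>k\<in>{0}. carleson_box (dyadic_arc n k))"
        proof
          fix z assume "z \<in> carleson_box I"
          then obtain r t where "z = rcis r t" "0 < r" "r < 1" using box by (auto simp: carleson_box_def)
          moreover have "\<lfloor>turn z\<rfloor> = 0" using turn_nonneg turn_less_1 by (simp add: floor_eq_iff)
          ultimately show "z \<in> (\<Union>k\<in>{0}. carleson_box (dyadic_arc n k))"
            using n by (simp add: carleson_box_dyadic_iff)
        qed
      qed auto
    next
      assume "J = {}"
      then have "carleson_box I = {}" using J by (simp add: carleson_box_def)
      then show ?thesis by (intro exI[of _ "{}"]) auto
    qed
  next
    case False
    then obtain a where a: "a \<in> J" by auto
    have "(1::real) / 2 ^ n < 1" using False by (simp add: field_simps)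
    then have l1: "arc_length I < 1" using l by linarith
    define p where "p = \<lfloor>2 ^ n * (a / (2 * pi))\<rfloor>"
    \<comment> \<open>Adjacency is cyclic: reduction modulo 2 ^ n puts index 2 ^ n - 1 before index
      0.\<close>
    define K where "K = (\<lambda>q. nat (q mod 2 ^ n)) ` {p - 1, p, p + 1}"
    have "K \<subseteq> {..<2 ^ n}" by (auto simp: K_def nat_less_iff)
    moreover have "card K \<le> 3"
    proof -
      have "card K \<le> card {p - 1, p, p + 1}" unfolding K_def by (rule card_image_le) auto
      also have "\<dots> \<le> 3" by (simp add: card_insert_if)
      finally show ?thesis .
    qed
    moreover have "carleson_box I \<subseteq> (\<Union>k\<in>K. carleson_box (dyadic_arc n k))"
    proof
      fix z assume "z \<in> carleson_box I"
      then obtain r t where z: "z = rcis r t" "1 - arc_length I < r" "r < 1" and "cis t \<in> I"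
        by (auto simp: carleson_box_def)
      then obtain b where b: "b \<in> J" "cis t = cis b" using J by auto
      have "\<bar>b - a\<bar> / (2 * pi) \<le> 1 / 2 ^ n"
        using arc_spread_le[OF J(1) a b(1)] l l1 unfolding J(2) by linarith
      then have "2 ^ n * (\<bar>b - a\<bar> / (2 * pi)) \<le> 1"
        by (simp add: field_simps)
      moreover have "2 ^ n * (\<bar>b - a\<bar> / (2 * pi)) = \<bar>2 ^ n * (b / (2 * pi)) - 2 ^ n * (a / (2 * pi))\<bar>"
        by (simp add: abs_mult flip: right_diff_distrib diff_divide_distrib)
      ultimately have "\<bar>2 ^ n * (b / (2 * pi)) - 2 ^ n * (a / (2 * pi))\<bar> \<le> 1"
        by metis
      then have "\<lfloor>2 ^ n * (b / (2 * pi))\<rfloor> \<in> {p - 1, p, p + 1}" (is "?q \<in> _")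
        unfolding p_def by (auto simp: abs_le_iff) linarith
      then have k: "nat (?q mod 2 ^ n) \<in> K" by (auto simp: K_def)
      moreover have "z \<in> carleson_box (dyadic_arc n (nat (?q mod 2 ^ n)))"
      proof (subst carleson_box_dyadic_iff)
        show "nat (?q mod 2 ^ n) < 2 ^ n" by (simp add: nat_less_iff)
        have "turn z = turn (cis b)" using z box b by (simp add: turn_rcis_cis)
        then show "1 - 1 / 2 ^ n < cmod z \<and> cmod z < 1 \<and> \<lfloor>2 ^ n * turn z\<rfloor> = int (nat (?q mod 2 ^ n))"
          using floor_turn_cis[of n b] z box[OF z(2)] by simp
      qed
      ultimately show "z \<in> (\<Union>k\<in>K. carleson_box (dyadic_arc n k))" by blast
    qed
    ultimately show ?thesis by blast
  qed
qed

section \<open>Reduction of the Carleson condition to dyadic arcs\<close>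

definition carleson_sum :: "real \<Rightarrow> complex set \<Rightarrow> (nat \<Rightarrow> complex) \<Rightarrow> ennreal" where
  "carleson_sum \<alpha> Q zs = (\<Sum>i. indicator Q (zs i) * ennreal ((1 - norm (zs i)) powr \<alpha>))"

lemma carleson_sum_cover:
  assumes "finite K" "A \<subseteq> (\<Union>k\<in>K. B k)"
  shows "carleson_sum \<alpha> A zs \<le> (\<Sum>k\<in>K. carleson_sum \<alpha> (B k) zs)"
proof -
  have "carleson_sum \<alpha> A zs \<le> (\<Sum>i. \<Sum>k\<in>K. indicator (B k) (zs i) * ennreal ((1 - norm (zs i)) powr \<alpha>))"
    unfolding carleson_sum_def
  proof (intro suminf_le allI)
    fix i
    show "indicator A (zs i) * ennreal ((1 - norm (zs i)) powr \<alpha>)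
        \<le> (\<Sum>k\<in>K. indicator (B k) (zs i) * ennreal ((1 - norm (zs i)) powr \<alpha>))"
    proof (cases "zs i \<in> A")
      case True
      then obtain k where k: "k \<in> K" "zs i \<in> B k" using assms by auto
      have "indicator A (zs i) * ennreal ((1 - norm (zs i)) powr \<alpha>) =
         indicator (B k) (zs i) * ennreal ((1 - norm (zs i)) powr \<alpha>)" using True k by simp
      also have "\<dots> \<le> (\<Sum>k\<in>K. indicator (B k) (zs i) * ennreal ((1 - norm (zs i)) powr \<alpha>))"
        using k assms by (intro member_le_sum) auto
      finally show ?thesis .
    qed simp
  qed auto
  also have "\<dots> = (\<Sum>k\<in>K. carleson_sum \<alpha> (B k) zs)"
    unfolding carleson_sum_def by (simp add: suminf_sum)
  finally show ?thesis .
qed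

text \<open>Rounding the length up to a power of 1 / 2 and covering by three dyadic arcs costs only
  a constant factor. The constant is a natural number so that the condition becomes a countable
  combination, from which measurability follows later.\<close>

lemma carleson_sequence_iff_dyadic:
  assumes \<alpha>: "0 < \<alpha>"
  shows "carleson_sequence \<alpha> zs \<longleftrightarrow> (\<exists>C::nat. \<forall>n. \<forall>k<2 ^ n.
    carleson_sum \<alpha> (carleson_box (dyadic_arc n k)) zs \<le> ennreal (real C * (1 / 2 ^ n) powr \<alpha>))"
proof
  assume "carleson_sequence \<alpha> zs"
  then obtain C where C: "C > 0" "\<And>I. is_circle_arc I \<Longrightarrow>
      carleson_sum \<alpha> (carleson_box I) zs \<le> ennreal (C * arc_length I powr \<alpha>)"
    unfolding carleson_sequence_def carleson_sum_def by blast
  have "carleson_sum \<alpha> (carleson_box (dyadic_arc n k)) zs \<le> ennreal (real (nat \<lceil>C\<rceil>) * (1 / 2 ^ n) powr \<alpha>)"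
    if "k < 2 ^ n" for n k
  proof -
    have "carleson_sum \<alpha> (carleson_box (dyadic_arc n k)) zs \<le> ennreal (C * (1 / 2 ^ n) powr \<alpha>)"
      using C(2)[OF is_circle_arc_dyadic_arc, of n k] that by (simp add: arc_length_dyadic_arc)
    also have "\<dots> \<le> ennreal (real (nat \<lceil>C\<rceil>) * (1 / 2 ^ n) powr \<alpha>)"
      by (intro ennreal_leI mult_right_mono) (auto simp: of_nat_ceiling)
    finally show ?thesis .
  qed
  then show "\<exists>C::nat. \<forall>n. \<forall>k<2 ^ n.
    carleson_sum \<alpha> (carleson_box (dyadic_arc n k)) zs \<le> ennreal (real C * (1 / 2 ^ n) powr \<alpha>)" by blast
next
  assume "\<exists>C::nat. \<forall>n. \<forall>k<2 ^ n.
    carleson_sum \<alpha> (carleson_box (dyadic_arc n k)) zs \<le> ennreal (real C * (1 / 2 ^ n) powr \<alpha>)"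
  then obtain C :: nat where C: "\<And>n k. k < 2 ^ n \<Longrightarrow>
    carleson_sum \<alpha> (carleson_box (dyadic_arc n k)) zs \<le> ennreal (real C * (1 / 2 ^ n) powr \<alpha>)" by blast
  \<comment> \<open>3 counts the arcs of the cover, 2 powr \<alpha> comes from 1 / 2 ^ n < 2 *
    \<open>arc_length I\<close>, and the summand 1 makes the constant positive.\<close>
  define C' where "C' = 3 * real C * 2 powr \<alpha> + 1"
  have "C' > 0" by (simp add: C'_def add_nonneg_pos)
  moreover have "carleson_sum \<alpha> (carleson_box I) zs \<le> ennreal (C' * arc_length I powr \<alpha>)"
    if I: "is_circle_arc I" for I
  proof (cases "arc_length I > 0")
    case True
    then obtain n where n: "1 / 2 ^ (n + 1) < arc_length I" "arc_length I \<le> 1 / 2 ^ n"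
      using ex_dyadic_level[of "arc_length I"] arc_length_le_1 by blast
    obtain K where K: "K \<subseteq> {..<2 ^ n}" "card K \<le> 3" "carleson_box I \<subseteq> (\<Union>k\<in>K. carleson_box (dyadic_arc n k))"
      using carleson_box_cover[OF I n(2)] by blast
    have "finite K" using K(1) finite_subset by blast
    then have "carleson_sum \<alpha> (carleson_box I) zs \<le> (\<Sum>k\<in>K. carleson_sum \<alpha> (carleson_box (dyadic_arc n k)) zs)"
      using K(3) by (rule carleson_sum_cover)
    also have "\<dots> \<le> (\<Sum>k\<in>K. ennreal (real C * (1 / 2 ^ n) powr \<alpha>))"
      using K(1) by (intro sum_mono C) auto
    also have "\<dots> = ennreal (real (card K) * (real C * (1 / 2 ^ n) powr \<alpha>))"
      by (simp add: ennreal_mult ennreal_of_nat_eq_real_of_nat)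
    also have "\<dots> \<le> ennreal (C' * arc_length I powr \<alpha>)"
    proof (rule ennreal_leI)
      have "(1 / 2 ^ n) powr \<alpha> \<le> (2 * arc_length I) powr \<alpha>"
        using n \<alpha> by (intro powr_mono2) (auto simp: field_simps)
      also have "\<dots> = 2 powr \<alpha> * arc_length I powr \<alpha>" using True by (simp add: powr_mult)
      finally have "real (card K) * (real C * (1 / 2 ^ n) powr \<alpha>) \<le> 3 * (real C * (2 powr \<alpha> * arc_length I powr \<alpha>))"
        using K(2) by (intro mult_mono) auto
      also have "\<dots> \<le> C' * arc_length I powr \<alpha>" by (simp add: C'_def algebra_simps)
      finally show "real (card K) * (real C * (1 / 2 ^ n) powr \<alpha>) \<le> C' * arc_length I powr \<alpha>" .
    qed
    finally show ?thesis .
  next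
    case False
    then have "carleson_box I = {}" by (auto simp: carleson_box_def)
    then show ?thesis by (simp add: carleson_sum_def)
  qed
  ultimately show "carleson_sequence \<alpha> zs" unfolding carleson_sequence_def carleson_sum_def by blast
qed

section \<open>Poisson tail estimates\<close>

definition pois :: "real \<Rightarrow> nat \<Rightarrow> real" where
  "pois r k = r ^ k / fact k * exp (- r)"

lemma pois_nonneg: "0 \<le> r \<Longrightarrow> 0 \<le> pois r k"
  by (simp add: pois_def)

lemma pois_sums: "pois r sums 1"
proof -
  have "(\<lambda>k. r ^ k /\<^sub>R fact k) sums exp r" by (rule exp_converges)
  then have "(\<lambda>k. r ^ k / fact k * exp (- r)) sums (exp r * exp (- r))"
    by (intro sums_mult2) (simp add: divide_inverse mult.commute)
  then show ?thesis by (simp add: pois_def[abs_def] exp_minus)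
qed

text \<open>The moment generating function of the Poisson law, from the exponential series at
  \<open>r * exp t\<close>.\<close>

lemma suminf_exp_pois:
  assumes "0 \<le> r"
  shows "(\<Sum>k. ennreal (exp (t * real k)) * ennreal (pois r k)) = ennreal (exp (r * (exp t - 1)))"
proof -
  have "(\<lambda>k. (r * exp t) ^ k /\<^sub>R fact k) sums exp (r * exp t)" by (rule exp_converges)
  then have "(\<lambda>k. (r * exp t) ^ k /\<^sub>R fact k * exp (- r)) sums (exp (r * exp t) * exp (- r))"
    by (intro sums_mult2)
  moreover have "(r * exp t) ^ k /\<^sub>R fact k * exp (- r) = exp (t * real k) * pois r k" for k
    by (simp add: pois_def power_mult_distrib exp_of_nat2_mult[symmetric] divide_inverse mult_ac)
  ultimately have "(\<lambda>k. exp (t * real k) * pois r k) sums exp (r * (exp t - 1))"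
    by (simp add: algebra_simps flip: exp_add)
  then have "(\<Sum>k. ennreal (exp (t * real k) * pois r k)) = ennreal (exp (r * (exp t - 1)))"
    using assms by (intro suminf_ennreal_eq) (auto simp: pois_nonneg)
  then show ?thesis using assms by (simp add: ennreal_mult pois_nonneg)
qed

text \<open>Each term of index \<open>k < K\<close> is compared with the term of index \<open>k + K\<close>.\<close>

lemma pois_lower_tail_le:
  assumes r: "0 \<le> r"
  shows "(\<Sum>k<K. pois r k) \<le> exp (- (min r 1 ^ K / (2 * fact (2 * K))))"
proof -
  \<comment> \<open>Chosen so that \<open>x * pois r k\<close> is at most
    \<open>pois r (k + K)\<close> for all k < K at once; truncating r at 1 keeps x in
    [0, 1].\<close>
  define x where "x = min r 1 ^ K / fact (2 * K)"
  have "min r 1 ^ K \<le> 1" using r by (intro power_le_one) auto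
  moreover have "(1::real) \<le> fact (2 * K)" by (rule fact_ge_1)
  ultimately have "min r 1 ^ K \<le> fact (2 * K)" by linarith
  then have x: "0 \<le> x" "x \<le> 1" using r by (auto simp: x_def)
  define q where "q = (\<Sum>k<K. pois r k)"
  have "x * pois r k \<le> pois r (k + K)" if "k < K" for k
  proof -
    have "min r 1 ^ K \<le> r ^ K" using r by (intro power_mono) auto
    moreover have "fact (k + K) \<le> (fact (2 * K) :: real)" using that by (intro fact_mono) auto
    moreover have "(1::real) \<le> fact k" by (rule fact_ge_1)
    ultimately have "x * (1 / fact k) \<le> r ^ K / fact (k + K) * 1"
      unfolding x_def using r by (intro mult_mono frac_le) auto
    then have "x * (1 / fact k) * (r ^ k * exp (- r)) \<le> r ^ K / fact (k + K) * 1 * (r ^ k * exp (- r))"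
      using r by (intro mult_right_mono) auto
    then show ?thesis by (simp add: pois_def power_add mult_ac)
  qed
  then have "x * q \<le> (\<Sum>k<K. pois r (k + K))" unfolding q_def sum_distrib_left by (intro sum_mono) auto
  also have "\<dots> = (\<Sum>k\<in>{K..<2 * K}. pois r k)"
    using sum.shift_bounds_nat_ivl[of "pois r" 0 K K] by (simp add: lessThan_atLeast0 mult_2)
  finally have "q + x * q \<le> q + (\<Sum>k\<in>{K..<2 * K}. pois r k)" by simp
  also have "\<dots> = (\<Sum>k<2 * K. pois r k)"
    unfolding q_def lessThan_atLeast0 by (rule sum.atLeastLessThan_concat) auto
  also have "\<dots> \<le> 1"
    using pois_sums[of r] r by (metis finite_lessThan pois_nonneg sum_le_suminf sums_iff)
  finally have "q * (1 + x) \<le> 1" by (simp add: algebra_simps)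
  \<comment> \<open>The lower tail q and a shifted mass of at least x q fit into total mass 1, so q
    \<le> 1 / (1 + x). On [0, 1] this is at most 1 - x / 2, which has the exponential bound.\<close>
  moreover have "1 \<le> (1 - x / 2) * (1 + x)"
  proof -
    have "x * x \<le> x * 1" using x by (intro mult_left_mono) auto
    then show ?thesis by (simp add: field_simps)
  qed
  ultimately have "q * (1 + x) \<le> (1 - x / 2) * (1 + x)" by linarith
  then have "q \<le> 1 - x / 2" using x by (simp add: mult_le_cancel_right)
  also have "\<dots> \<le> exp (- (x / 2))" using exp_ge_add_one_self[of "- (x / 2)"] by simp
  finally show ?thesis unfolding q_def x_def by (simp only: divide_divide_eq_left mult.commute)
qed

text \<open>The masses at the naturals already sum to 1, so no probability is left for \<infinity>
  or for other values in \<open>ennreal\<close>.\<close>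

lemma poisson_variable_AE_nat:
  assumes "prob_space M" "poisson_variable M (ennreal r) X" "0 \<le> r"
  shows "AE \<omega> in M. \<exists>k::nat. X \<omega> = of_nat k"
proof -
  interpret prob_space M by fact
  have X[measurable]: "X \<in> borel_measurable M" using assms(2) by (simp add: poisson_variable_def)
  have P: "prob {\<omega> \<in> space M. X \<omega> = of_nat k} = pois r k" for k
    using assms(2,3) by (simp add: poisson_variable_def pois_def)
  have "(\<lambda>k. prob {\<omega> \<in> space M. X \<omega> = of_nat k}) sums prob (\<Union>k. {\<omega> \<in> space M. X \<omega> = of_nat k})"
    by (intro finite_measure_UNION) (auto simp: disjoint_family_on_def)
  then have "prob (\<Union>k. {\<omega> \<in> space M. X \<omega> = of_nat k}) = 1"
    unfolding P using pois_sums sums_unique2 by blast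
  then have "AE \<omega> in M. \<omega> \<in> (\<Union>k. {\<omega> \<in> space M. X \<omega> = of_nat k})"
    by (intro prob_eq_1[THEN iffD1]) auto
  then show ?thesis by eventually_elim auto
qed

lemma nn_integral_poisson_variable:
  assumes "prob_space M" "poisson_variable M (ennreal r) X" "0 \<le> r"
    and [measurable]: "f \<in> borel_measurable borel"
  shows "(\<integral>\<^sup>+\<omega>. f (X \<omega>) \<partial>M) = (\<Sum>k. f (of_nat k) * ennreal (pois r k))"
proof -
  interpret prob_space M by fact
  have X[measurable]: "X \<in> borel_measurable M" using assms(2) by (simp add: poisson_variable_def)
  have P: "prob {\<omega> \<in> space M. X \<omega> = of_nat k} = pois r k" for k
    using assms(2,3) by (simp add: poisson_variable_def pois_def)
  have "(\<integral>\<^sup>+\<omega>. f (X \<omega>) \<partial>M) = (\<integral>\<^sup>+\<omega>. (\<Sum>k. f (of_nat k) * indicator {\<omega> \<in> space M. X \<omega> = of_nat k} \<omega>) \<partial>M)"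
  proof (rule nn_integral_cong_AE)
    show "AE \<omega> in M. f (X \<omega>) = (\<Sum>k. f (of_nat k) * indicator {\<omega> \<in> space M. X \<omega> = of_nat k} \<omega>)"
      using poisson_variable_AE_nat[OF assms(1-3)] AE_space
    proof eventually_elim
      case (elim \<omega>)
      then obtain k :: nat where k: "X \<omega> = of_nat k" by auto
      have "(\<Sum>j. f (of_nat j) * indicator {\<omega> \<in> space M. X \<omega> = of_nat j} \<omega>) =
        (\<Sum>j\<in>{k}. f (of_nat j) * indicator {\<omega> \<in> space M. X \<omega> = of_nat j} \<omega>)"
        using k by (intro suminf_finite) (auto simp: indicator_def)
      then show ?case using k elim by simp
    qed
  qed
  also have "\<dots> = (\<Sum>k. f (of_nat k) * ennreal (pois r k))"
    by (simp add: nn_integral_suminf nn_integral_cmult_indicator emeasure_eq_measure P)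
  finally show ?thesis .
qed

section \<open>Counts in dyadic boxes: independence, exponential moments and tails\<close>

definition boxes :: "(nat \<times> nat) set" where
  "boxes = {(n, k). k < 2 ^ n}"

locale poisson_process =
  fixes M :: "'w measure" and \<mu> :: "complex measure" and \<Lambda> :: "'w \<Rightarrow> nat \<Rightarrow> complex"
  assumes intensity: "intensity_measure \<mu>" and process: "poisson_point_process M \<mu> \<Lambda>"
begin

sublocale prob_space M
  using process by (simp add: poisson_point_process_def)

definition tile :: "nat \<times> nat \<Rightarrow> complex set" where
  "tile b = dyadic_box (fst b) (snd b)"

definition N :: "nat \<times> nat \<Rightarrow> 'w \<Rightarrow> ennreal" where
  "N b \<omega> = num_points (\<Lambda> \<omega>) (tile b)"

definition w :: "nat \<times> nat \<Rightarrow> real" where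
  "w b = measure \<mu> (tile b)"

lemma w_nonneg: "0 \<le> w b"
  by (simp add: w_def)

lemma sets_\<mu>: "sets \<mu> = sets (restrict_space borel unit_disk)"
  using intensity by (simp add: intensity_measure_def)

lemma in_sets_\<mu>: "A \<in> sets borel \<Longrightarrow> A \<subseteq> unit_disk \<Longrightarrow> A \<in> sets \<mu>"
  by (simp add: sets_\<mu> sets_restrict_space_iff)

lemma \<Lambda>_measurable [measurable]: "(\<lambda>\<omega>. \<Lambda> \<omega> i) \<in> borel_measurable M"
proof -
  have "(\<lambda>\<omega>. \<Lambda> \<omega> i) \<in> measurable M \<mu>" using process by (simp add: poisson_point_process_def)
  then have "(\<lambda>\<omega>. \<Lambda> \<omega> i) \<in> measurable M (restrict_space borel unit_disk)"
    using measurable_cong_sets[OF refl sets_\<mu>] by blast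
  then show ?thesis by (rule measurable_restrict_space2_iff[THEN iffD1, THEN conjunct1])
qed

lemma tile_sets: "b \<in> boxes \<Longrightarrow> tile b \<in> sets \<mu>"
  unfolding boxes_def tile_def
  by (intro in_sets_\<mu> dyadic_box_borel dyadic_box_subset_disk) auto

text \<open>The box lies in a closed ball inside the disk, so local finiteness rules out infinite
  mass.\<close>

lemma emeasure_tile: "b \<in> boxes \<Longrightarrow> emeasure \<mu> (tile b) = ennreal (w b)"
proof -
  assume b: "b \<in> boxes"
  let ?K = "cball (0::complex) (1 - 1 / 2 ^ (fst b + 1))"
  have "?K \<subseteq> unit_disk"
  proof -
    have "0 < (1::real) / 2 ^ (fst b + 1)" by simp
    then show ?thesis unfolding subset_iff mem_cball mem_ball by (intro allI impI) linarith
  qed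
  moreover have "compact ?K" by simp
  ultimately have K: "emeasure \<mu> ?K < \<infinity>" "?K \<in> sets \<mu>"
    using intensity in_sets_\<mu>[of ?K] by (auto simp: intensity_measure_def)
  have "emeasure \<mu> (tile b) \<le> emeasure \<mu> ?K"
    using b dyadic_box_subset_cball[of "snd b" "fst b"] unfolding boxes_def tile_def
    by (intro emeasure_mono K(2)) (simp add: case_prod_unfold)
  with K have "emeasure \<mu> (tile b) < \<infinity>" by (meson le_less_trans)
  then show ?thesis unfolding w_def by (intro emeasure_eq_ennreal_measure) auto
qed

lemma poisson_N: "b \<in> boxes \<Longrightarrow> poisson_variable M (ennreal (w b)) (N b)"
  using process tile_sets[of b] emeasure_tile[of b]
  unfolding poisson_point_process_def N_def[abs_def] by metis

lemma N_measurable [measurable]: "b \<in> boxes \<Longrightarrow> N b \<in> borel_measurable M"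
  using poisson_N by (simp add: poisson_variable_def)

lemma AE_N_finite: "b \<in> boxes \<Longrightarrow> AE \<omega> in M. N b \<omega> < \<infinity>"
proof -
  assume "b \<in> boxes"
  from poisson_variable_AE_nat[OF prob_space_axioms poisson_N[OF this] w_nonneg]
  show ?thesis by eventually_elim (auto simp: of_nat_less_top)
qed

text \<open>The process provides independence for sequences of disjoint sets. Pairs are therefore
  enumerated by \<open>prod_decode\<close>, with the empty set at pairs that are no boxes, and the
  expectation of the product factorises.\<close>

lemma indep_N:
  assumes B: "finite B" "B \<subseteq> boxes" and f: "\<And>b. b \<in> B \<Longrightarrow> f b \<in> borel_measurable borel"
  shows "(\<integral>\<^sup>+\<omega>. (\<Prod>b\<in>B. f b (N b \<omega>)) \<partial>M) = (\<Prod>b\<in>B. \<Sum>k. f b (of_nat k) * ennreal (pois (w b) k))"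
proof -
  define A where "A i = (if prod_decode i \<in> boxes then tile (prod_decode i) else {})" for i
  have "disjoint_family A"
  proof -
    have "A i \<inter> A j = {}" if "i \<noteq> j" for i j
    proof (rule ccontr)
      assume "A i \<inter> A j \<noteq> {}"
      then obtain z where "z \<in> A i" "z \<in> A j" by auto
      then have "prod_decode i = prod_decode j"
        using dyadic_box_unique[of z "fst (prod_decode i)" "snd (prod_decode i)" "fst (prod_decode j)" "snd (prod_decode j)"]
        by (auto simp: A_def boxes_def tile_def prod_eq_iff split: if_splits)
      with that show False by simp
    qed
    then show ?thesis by (auto simp: disjoint_family_on_def)
  qed
  moreover have "range A \<subseteq> sets \<mu>" by (auto simp: A_def intro: tile_sets)
  ultimately have "indep_vars (\<lambda>_. borel) (\<lambda>i \<omega>. num_points (\<Lambda> \<omega>) (A i)) UNIV"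
    using process unfolding poisson_point_process_def by blast
  then have "indep_vars (\<lambda>_. borel) (\<lambda>i \<omega>. num_points (\<Lambda> \<omega>) (A i)) (prod_encode ` B)"
    by (rule indep_vars_subset) simp
  then have ind: "indep_vars (\<lambda>_. borel) (\<lambda>i \<omega>. f (prod_decode i) (num_points (\<Lambda> \<omega>) (A i))) (prod_encode ` B)"
    by (rule indep_vars_compose2) (auto simp: f)
  have eq: "num_points (\<Lambda> \<omega>) (A (prod_encode b)) = N b \<omega>" if "b \<in> B" for b \<omega>
    using that B by (auto simp: A_def N_def)
  have "(\<integral>\<^sup>+\<omega>. (\<Prod>b\<in>B. f b (N b \<omega>)) \<partial>M) =
      (\<integral>\<^sup>+\<omega>. (\<Prod>i\<in>prod_encode ` B. f (prod_decode i) (num_points (\<Lambda> \<omega>) (A i))) \<partial>M)"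
    by (subst prod.reindex) (auto simp: inj_prod_encode eq)
  also have "\<dots> = (\<Prod>i\<in>prod_encode ` B. \<integral>\<^sup>+\<omega>. f (prod_decode i) (num_points (\<Lambda> \<omega>) (A i)) \<partial>M)"
    using B ind by (intro indep_vars_nn_integral) auto
  also have "\<dots> = (\<Prod>b\<in>B. \<integral>\<^sup>+\<omega>. f b (N b \<omega>) \<partial>M)"
    by (subst prod.reindex) (auto simp: inj_prod_encode eq)
  also have "\<dots> = (\<Prod>b\<in>B. \<Sum>k. f b (of_nat k) * ennreal (pois (w b) k))"
    using B f by (intro prod.cong refl nn_integral_poisson_variable prob_space_axioms poisson_N w_nonneg) auto
  finally show ?thesis .
qed

text \<open>Independence reduces this to Poisson moment generating functions. Convexity of exp
  between 0 and t gives exp (t c) - 1 \<le> c (exp t - 1), so that only the mean of the weighted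
  count enters; t may have either sign.\<close>

lemma exp_moment_le:
  assumes B: "finite B" "B \<subseteq> boxes" and c: "\<And>b. b \<in> B \<Longrightarrow> 0 \<le> c b" "\<And>b. b \<in> B \<Longrightarrow> c b \<le> 1"
  shows "(\<integral>\<^sup>+\<omega>. ennreal (exp (t * (\<Sum>b\<in>B. c b * enn2real (N b \<omega>)))) \<partial>M)
    \<le> ennreal (exp ((exp t - 1) * (\<Sum>b\<in>B. c b * w b)))"
proof -
  have "(\<integral>\<^sup>+\<omega>. ennreal (exp (t * (\<Sum>b\<in>B. c b * enn2real (N b \<omega>)))) \<partial>M) =
     (\<integral>\<^sup>+\<omega>. (\<Prod>b\<in>B. ennreal (exp (t * c b * enn2real (N b \<omega>)))) \<partial>M)"
    using B by (simp add: prod_ennreal sum_distrib_left exp_sum mult.assoc)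
  also have "\<dots> = (\<Prod>b\<in>B. \<Sum>k. ennreal (exp (t * c b * enn2real (of_nat k))) * ennreal (pois (w b) k))"
    using indep_N[OF B, of "\<lambda>b x. ennreal (exp (t * c b * enn2real x))"] by simp
  also have "\<dots> = (\<Prod>b\<in>B. ennreal (exp (w b * (exp (t * c b) - 1))))"
    using suminf_exp_pois[OF w_nonneg] by (simp add: enn2real_of_nat)
  also have "\<dots> = ennreal (exp (\<Sum>b\<in>B. w b * (exp (t * c b) - 1)))"
    using B by (simp add: prod_ennreal exp_sum)
  also have "\<dots> \<le> ennreal (exp (\<Sum>b\<in>B. (exp t - 1) * (c b * w b)))"
  proof (intro ennreal_leI, subst exp_le_cancel_iff, intro sum_mono)
    fix b assume "b \<in> B"
    with c have "exp ((1 - c b) *\<^sub>R 0 + c b *\<^sub>R t) \<le> (1 - c b) * exp 0 + c b * exp t"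
      by (intro convex_onD[OF exp_convex]) auto
    then have "exp (t * c b) - 1 \<le> c b * (exp t - 1)" by (simp add: algebra_simps)
    then have "w b * (exp (t * c b) - 1) \<le> w b * (c b * (exp t - 1))"
      by (intro mult_left_mono w_nonneg)
    then show "w b * (exp (t * c b) - 1) \<le> (exp t - 1) * (c b * w b)" by (simp add: mult_ac)
  qed
  finally show ?thesis by (simp add: sum_distrib_left)
qed

definition wsum :: "(nat \<times> nat \<Rightarrow> real) \<Rightarrow> (nat \<times> nat) set \<Rightarrow> 'w \<Rightarrow> ennreal" where
  "wsum c B \<omega> = (\<Sum>b\<in>B. ennreal (c b) * N b \<omega>)"

lemma wsum_measurable [measurable]: "B \<subseteq> boxes \<Longrightarrow> wsum c B \<in> borel_measurable M"
  unfolding wsum_def[abs_def] by (intro borel_measurable_sum borel_measurable_times_ennreal) auto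

lemma AE_wsum:
  assumes B: "finite B" "B \<subseteq> boxes" and c: "\<And>b. b \<in> B \<Longrightarrow> 0 \<le> c b"
  shows "AE \<omega> in M. wsum c B \<omega> = ennreal (\<Sum>b\<in>B. c b * enn2real (N b \<omega>))"
proof -
  have "AE \<omega> in M. \<forall>b\<in>B. N b \<omega> < \<infinity>"
    using B AE_N_finite by (subst AE_finite_all) auto
  then show ?thesis
  proof eventually_elim
    case (elim \<omega>)
    then have "wsum c B \<omega> = (\<Sum>b\<in>B. ennreal (c b * enn2real (N b \<omega>)))"
      unfolding wsum_def using c by (intro sum.cong refl) (auto simp: ennreal_mult)
    then show ?case using c by (simp add: sum_ennreal)
  qed
qed

text \<open>Markov's inequality for exp (t X). Describing the event by t C \<le> t x lets one
  statement serve both the upper tail (t \<ge> 0) and the lower tail (t < 0).\<close>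

lemma chernoff:
  assumes B: "finite B" "B \<subseteq> boxes" and c: "\<And>b. b \<in> B \<Longrightarrow> 0 \<le> c b" "\<And>b. b \<in> B \<Longrightarrow> c b \<le> 1"
    and A: "A \<in> events" and
      le: "\<And>\<omega> x. \<omega> \<in> A \<Longrightarrow> 0 \<le> x \<Longrightarrow> wsum c B \<omega> = ennreal x \<Longrightarrow> t * C \<le> t * x"
  shows "prob A \<le> exp ((exp t - 1) * (\<Sum>b\<in>B. c b * w b) - t * C)"
proof -
  define X where "X \<omega> = (\<Sum>b\<in>B. c b * enn2real (N b \<omega>))" for \<omega>
  have [measurable]: "X \<in> borel_measurable M"
    unfolding X_def[abs_def] using B by (intro borel_measurable_sum) auto
  have AE_X: "AE \<omega> in M. wsum c B \<omega> = ennreal (X \<omega>)"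
    unfolding X_def using B c by (intro AE_wsum)
  have "emeasure M A = (\<integral>\<^sup>+\<omega>. indicator A \<omega> \<partial>M)" using A by simp
  also have "\<dots> \<le> (\<integral>\<^sup>+\<omega>. ennreal (exp (- (t * C))) * ennreal (exp (t * X \<omega>)) \<partial>M)"
  proof (rule nn_integral_mono_AE)
    show "AE \<omega> in M. indicator A \<omega> \<le> ennreal (exp (- (t * C))) * ennreal (exp (t * X \<omega>))"
      using AE_X
    proof eventually_elim
      case (elim \<omega>)
      show ?case
      proof (cases "\<omega> \<in> A")
        case True
        have "0 \<le> X \<omega>" unfolding X_def using c by (intro sum_nonneg) auto
        with True elim have "t * C \<le> t * X \<omega>" by (intro le)
        then have "1 \<le> exp (- (t * C) + t * X \<omega>)" by simp
        then have "1 \<le> exp (- (t * C)) * exp (t * X \<omega>)" by (simp only: exp_add)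
        then have "ennreal 1 \<le> ennreal (exp (- (t * C)) * exp (t * X \<omega>))" by (rule ennreal_leI)
        then show ?thesis using True by (simp only: ennreal_mult exp_ge_zero ennreal_1 indicator_simps)
      qed simp
    qed
  qed
  also have "\<dots> = ennreal (exp (- (t * C))) * (\<integral>\<^sup>+\<omega>. ennreal (exp (t * X \<omega>)) \<partial>M)"
    by (rule nn_integral_cmult) measurable
  also have "\<dots> \<le> ennreal (exp (- (t * C))) * ennreal (exp ((exp t - 1) * (\<Sum>b\<in>B. c b * w b)))"
    unfolding X_def using exp_moment_le[of B c t, OF B c] by (intro mult_left_mono) auto
  also have "\<dots> = ennreal (exp ((exp t - 1) * (\<Sum>b\<in>B. c b * w b) - t * C))"
    by (simp add: exp_add[symmetric] flip: ennreal_mult)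
  finally show ?thesis by (simp add: emeasure_eq_measure)
qed

lemma prob_wsum_greater_le:
  assumes B: "finite B" "B \<subseteq> boxes" and c: "\<And>b. b \<in> B \<Longrightarrow> 0 \<le> c b" "\<And>b. b \<in> B \<Longrightarrow> c b \<le> 1"
    and t: "0 \<le> t" and C: "0 \<le> C" and \<epsilon>: "(\<Sum>b\<in>B. c b * w b) \<le> \<epsilon>"
  shows "prob {\<omega> \<in> space M. ennreal C < wsum c B \<omega>} \<le> exp ((exp t - 1) * \<epsilon> - t * C)"
proof -
  have "prob {\<omega> \<in> space M. ennreal C < wsum c B \<omega>} \<le> exp ((exp t - 1) * (\<Sum>b\<in>B. c b * w b) - t * C)"
  proof (rule chernoff[OF B c])
    show "t * C \<le> t * x" if "\<omega> \<in> {\<omega> \<in> space M. ennreal C < wsum c B \<omega>}" "0 \<le> x" "wsum c B \<omega> = ennreal x" for \<omega> x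
      using that t C by (intro mult_left_mono) (auto simp: ennreal_less_iff)
  qed (use B in measurable)
  also have "(exp t - 1) * (\<Sum>b\<in>B. c b * w b) \<le> (exp t - 1) * \<epsilon>"
    using \<epsilon> t by (intro mult_left_mono) auto
  finally show ?thesis by simp
qed

lemma prob_wsum_le_le:
  assumes B: "finite B" "B \<subseteq> boxes" and c: "\<And>b. b \<in> B \<Longrightarrow> 0 \<le> c b" "\<And>b. b \<in> B \<Longrightarrow> c b \<le> 1"
    and C: "0 \<le> C"
  shows "prob {\<omega> \<in> space M. wsum c B \<omega> \<le> ennreal C} \<le> exp (C - (\<Sum>b\<in>B. c b * w b) / 2)"
proof -
  define s where "s = (\<Sum>b\<in>B. c b * w b)"
  have "0 \<le> s" unfolding s_def using c w_nonneg by (intro sum_nonneg) auto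
  \<comment> \<open>The lower tail uses t = -1; this estimate is the origin of the factor 1 / 2 in
    front of the mean.\<close>
  moreover have "exp (-1) \<le> (1 / 2 :: real)"
    using exp_ge_add_one_self[of 1] by (simp add: exp_minus field_simps)
  ultimately have "(exp (-1) - 1) * s \<le> (- 1 / 2) * s" by (intro mult_right_mono) auto
  moreover have "prob {\<omega> \<in> space M. wsum c B \<omega> \<le> ennreal C} \<le> exp ((exp (-1) - 1) * (\<Sum>b\<in>B. c b * w b) - (-1) * C)"
  proof (rule chernoff[OF B c])
    show "-1 * C \<le> -1 * x" if "\<omega> \<in> {\<omega> \<in> space M. wsum c B \<omega> \<le> ennreal C}" "0 \<le> x" "wsum c B \<omega> = ennreal x" for \<omega> x
      using that C by auto
  qed (use B in measurable)
  ultimately show ?thesis unfolding s_def[symmetric]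
    by (elim order_trans) auto
qed

text \<open>By independence this is a product of Poisson lower tails. Bounding each by an
  exponential turns the product into a sum, whose divergence later forces probability 0.\<close>

lemma prob_all_N_less_le:
  assumes B: "finite B" "B \<subseteq> boxes"
  shows "prob {\<omega> \<in> space M. \<forall>b\<in>B. N b \<omega> < of_nat K}
    \<le> exp (- (\<Sum>b\<in>B. min (w b) 1 ^ K / (2 * fact (2 * K))))"
proof -
  let ?A = "{\<omega> \<in> space M. \<forall>b\<in>B. N b \<omega> < of_nat K}"
  let ?f = "\<lambda>x::ennreal. indicator {..<of_nat K} x :: ennreal"
  have [measurable]: "?A \<in> events"
    by (intro sets.sets_Collect_finite_All) (use B in auto)
  have "emeasure M ?A = (\<integral>\<^sup>+\<omega>. indicator ?A \<omega> \<partial>M)" by simp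
  also have "\<dots> = (\<integral>\<^sup>+\<omega>. (\<Prod>b\<in>B. ?f (N b \<omega>)) \<partial>M)"
  proof (rule nn_integral_cong)
    fix \<omega> assume "\<omega> \<in> space M"
    then show "indicator ?A \<omega> = (\<Prod>b\<in>B. ?f (N b \<omega>))"
      using B by (auto simp: indicator_def prod_zero_iff)
  qed
  also have "\<dots> = (\<Prod>b\<in>B. \<Sum>k. ?f (of_nat k) * ennreal (pois (w b) k))"
    using indep_N[OF B, of "\<lambda>_. ?f"] by simp
  also have "\<dots> \<le> (\<Prod>b\<in>B. ennreal (exp (- (min (w b) 1 ^ K / (2 * fact (2 * K))))))"
  proof (rule prod_mono_ennreal)
    fix b
    have "(\<Sum>k. ?f (of_nat k) * ennreal (pois (w b) k)) = (\<Sum>k<K. ?f (of_nat k) * ennreal (pois (w b) k))"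
      by (intro suminf_finite) (auto simp: indicator_def)
    also have "\<dots> = ennreal (\<Sum>k<K. pois (w b) k)"
      by (simp add: pois_nonneg w_nonneg sum_ennreal)
    also have "\<dots> \<le> ennreal (exp (- (min (w b) 1 ^ K / (2 * fact (2 * K)))))"
      by (intro ennreal_leI pois_lower_tail_le w_nonneg)
    finally show "(\<Sum>k. ?f (of_nat k) * ennreal (pois (w b) k)) \<le> \<dots>" .
  qed
  also have "\<dots> = ennreal (exp (- (\<Sum>b\<in>B. min (w b) 1 ^ K / (2 * fact (2 * K)))))"
    using B by (simp add: prod_ennreal exp_sum sum_negf[symmetric])
  finally show ?thesis by (simp add: emeasure_eq_measure)
qed

end

section \<open>Chernoff bounds and Borel--Cantelli\<close>

lemma num_points_eq_suminf: "num_points zs A = (\<Sum>i. indicator A (zs i))"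
proof -
  have "num_points zs A = (\<integral>\<^sup>+i. indicator {i. zs i \<in> A} i \<partial>count_space UNIV)"
    unfolding num_points_def by simp
  also have "\<dots> = (\<Sum>i. indicator {i. zs i \<in> A} i)" by (rule nn_integral_count_space_nat)
  also have "\<dots> = (\<Sum>i. indicator A (zs i))" by (simp add: indicator_def)
  finally show ?thesis .
qed

text \<open>A dyadic box is not contained in the Carleson box of its own arc: its inner edge is
  excluded there by a strict inequality. Passing to the parent arc repairs this and only doubles the
  length.\<close>

lemma dyadic_box_subset_parent:
  assumes "j < 2 ^ Suc n"
  shows "dyadic_box (Suc n) j \<subseteq> carleson_box (dyadic_arc n (j div 2))"
proof
  fix z assume "z \<in> dyadic_box (Suc n) j"
  then have z: "1 / 2 ^ (Suc n + 1) < 1 - norm z" "1 - norm z \<le> 1 / 2 ^ Suc n" "\<lfloor>2 ^ Suc n * turn z\<rfloor> = int j"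
    using dyadic_box_iff[OF assms] by auto
  have j: "j div 2 < 2 ^ n" using assms by auto
  have "0 < (1::real) / 2 ^ (Suc n + 1)" by simp
  moreover have "(1::real) / 2 ^ Suc n < 1 / 2 ^ n" by (simp add: field_simps)
  moreover have "\<lfloor>2 ^ n * turn z\<rfloor> = int (j div 2)"
  proof -
    have "\<lfloor>2 ^ n * turn z\<rfloor> = \<lfloor>2 ^ Suc n * turn z / 2\<rfloor>" by simp
    also have "\<dots> = \<lfloor>2 ^ Suc n * turn z\<rfloor> div 2"
      using floor_divide_real_eq_div[of 2 "2 ^ Suc n * turn z"] by simp
    finally show ?thesis using z(3) by (simp add: zdiv_int)
  qed
  ultimately show "z \<in> carleson_box (dyadic_arc n (j div 2))"
    unfolding carleson_box_dyadic_iff[OF j] using z by linarith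
qed

section \<open>Finite trees of descendants and their weights\<close>

definition subtree :: "nat \<Rightarrow> nat \<Rightarrow> nat \<Rightarrow> (nat \<times> nat) set" where
  "subtree n k L = (\<lambda>(l, i). (n + l, k * 2 ^ l + i)) ` (SIGMA l:{..<L}. {..<2 ^ l})"

lemma finite_subtree: "finite (subtree n k L)"
  by (auto simp: subtree_def)

lemma subtree_mono: "L \<le> L' \<Longrightarrow> subtree n k L \<subseteq> subtree n k L'"
  unfolding subtree_def by (intro image_mono) auto

lemma child_less:
  fixes k l i n :: nat
  assumes "k < 2 ^ n" "i < 2 ^ l"
  shows "k * 2 ^ l + i < 2 ^ (n + l)"
proof -
  have "k * 2 ^ l + i < (k + 1) * 2 ^ l" using assms(2) by simp
  also have "\<dots> \<le> 2 ^ n * 2 ^ l" using assms(1) by (intro mult_right_mono) auto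
  finally show ?thesis by (simp add: power_add)
qed

lemma subtree_boxes: "k < 2 ^ n \<Longrightarrow> subtree n k L \<subseteq> boxes"
  by (auto simp: subtree_def boxes_def intro: child_less)

lemma sum_subtree: "(\<Sum>b\<in>subtree n k L. f b) = (\<Sum>l<L. \<Sum>i<2 ^ l. f (n + l, k * 2 ^ l + i))"
proof -
  have "inj_on (\<lambda>(l, i). (n + l, k * 2 ^ l + i)) (SIGMA l:{..<L}. {..<2 ^ l})"
    by (auto simp: inj_on_def)
  then show ?thesis unfolding subtree_def by (subst sum.reindex) (simp_all add: sum.Sigma case_prod_unfold)
qed

text \<open>The maximum of (1 - \<open>norm z\<close>) powr \<alpha> over the box b, relative to (1
  / 2 ^ n) powr \<alpha>. The truncated subtraction is exact on \<open>subtree n k L\<close>, where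
  n \<le> \<open>fst b\<close>.\<close>

definition depth_weight :: "real \<Rightarrow> nat \<Rightarrow> nat \<times> nat \<Rightarrow> real" where
  "depth_weight \<alpha> n b = (1 / 2 ^ (fst b - n)) powr \<alpha>"

lemma depth_weight_bounds:
  assumes "0 \<le> \<alpha>" shows "0 \<le> depth_weight \<alpha> n b" "depth_weight \<alpha> n b \<le> 1"
proof -
  show "depth_weight \<alpha> n b \<le> 1" unfolding depth_weight_def
    using assms powr_mono2[of \<alpha> "1 / 2 ^ (fst b - n)" 1] by simp
qed (simp add: depth_weight_def)

text \<open>The radius forces a generation m = n + l, and l further binary digits of
  \<open>turn z\<close> place the index between k 2 ^ l and (k + 1) 2 ^ l.\<close>

lemma dyadic_box_in_subtree:
  assumes k: "k < 2 ^ n" and z: "z \<in> carleson_box (dyadic_arc n k)"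
  obtains l i where "i < 2 ^ l" "z \<in> dyadic_box (n + l) (k * 2 ^ l + i)"
proof -
  from z have z: "1 - 1 / 2 ^ n < norm z" "norm z < 1" "\<lfloor>2 ^ n * turn z\<rfloor> = int k"
    using carleson_box_dyadic_iff[OF k] by auto
  obtain m where m: "1 / 2 ^ (m + 1) < 1 - norm z" "1 - norm z \<le> 1 / 2 ^ m"
    using ex_dyadic_level[of "1 - norm z"] z by auto
  have "n < m + 1"
  proof (rule ccontr)
    assume "\<not> n < m + 1"
    then have "(2::real) ^ (m + 1) \<le> 2 ^ n" by (intro power_increasing) auto
    then have "1 / 2 ^ n \<le> (1::real) / 2 ^ (m + 1)" by (intro divide_left_mono) auto
    with m z show False by linarith
  qed
  then obtain l where l: "m = n + l" using le_Suc_ex[of n m] by auto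
  define j where "j = nat \<lfloor>2 ^ m * turn z\<rfloor>"
  have j: "j < 2 ^ m" "int j = \<lfloor>2 ^ m * turn z\<rfloor>" using nat_floor_turn unfolding j_def by auto
  have zj: "z \<in> dyadic_box m j" unfolding dyadic_box_iff[OF j(1)] using m j by simp
  have "real k * 2 ^ l \<le> 2 ^ n * turn z * 2 ^ l" "2 ^ n * turn z * 2 ^ l < (real k + 1) * 2 ^ l"
    using z(3) by (auto simp: floor_eq_iff)
  then have "real (k * 2 ^ l) \<le> 2 ^ m * turn z" "2 ^ m * turn z < real (k * 2 ^ l + 2 ^ l)"
    by (auto simp: l power_add algebra_simps)
  then have "int (k * 2 ^ l) \<le> int j" "int j < int (k * 2 ^ l + 2 ^ l)"
    unfolding j(2) by (simp_all only: le_floor_iff floor_less_iff of_int_of_nat_eq)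
  then have "k * 2 ^ l \<le> j" "j < k * 2 ^ l + 2 ^ l" by (simp_all only: of_nat_le_iff of_nat_less_iff)
  then have "j = k * 2 ^ l + (j - k * 2 ^ l)" "j - k * 2 ^ l < 2 ^ l" by auto
  with zj l that show thesis by metis
qed

context poisson_process
begin

lemma N_eq_suminf: "N b \<omega> = (\<Sum>i. indicator (tile b) (\<Lambda> \<omega> i))"
  by (simp add: N_def num_points_eq_suminf)

text \<open>Only partial sums have to be bounded, and finitely many points lie in boxes of bounded
  depth. Hence a bound for finite trees that is uniform in L is enough.\<close>

lemma carleson_sum_le:
  assumes k: "k < 2 ^ n" and \<alpha>: "0 < \<alpha>" and C: "0 \<le> C"
    and le: "\<And>L. wsum (depth_weight \<alpha> n) (subtree n k L) \<omega> \<le> ennreal C"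
  shows "carleson_sum \<alpha> (carleson_box (dyadic_arc n k)) (\<Lambda> \<omega>) \<le> ennreal (C * (1 / 2 ^ n) powr \<alpha>)"
  unfolding carleson_sum_def
proof (rule suminf_le_const)
  define Q where "Q = carleson_box (dyadic_arc n k)"
  fix I
  define z where "z i = \<Lambda> \<omega> i" for i
  define c where "c = depth_weight \<alpha> n"
  have "\<exists>L. \<forall>i<I. z i \<in> Q \<longrightarrow> (\<exists>b\<in>subtree n k L. z i \<in> tile b)"
  proof (induction I)
    case (Suc I)
    then obtain L where L: "\<forall>i<I. z i \<in> Q \<longrightarrow> (\<exists>b\<in>subtree n k L. z i \<in> tile b)" by blast
    show ?case
    proof (cases "z I \<in> Q")
      case True
      then obtain l i where li: "i < 2 ^ l" "z I \<in> dyadic_box (n + l) (k * 2 ^ l + i)"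
        using dyadic_box_in_subtree[OF k] unfolding Q_def by metis
      define L' where "L' = max L (Suc l)"
      have "(n + l, k * 2 ^ l + i) \<in> subtree n k L'"
        unfolding subtree_def using li by (intro image_eqI[of _ _ "(l, i)"]) (auto simp: L'_def)
      then have "\<exists>b\<in>subtree n k L'. z I \<in> tile b" using li by (auto simp: tile_def intro!: bexI)
      moreover have "subtree n k L \<subseteq> subtree n k L'" by (intro subtree_mono) (simp add: L'_def)
      ultimately have "\<forall>i<Suc I. z i \<in> Q \<longrightarrow> (\<exists>b\<in>subtree n k L'. z i \<in> tile b)"
        using L unfolding less_Suc_eq by blast
      then show ?thesis by blast
    next
      case False
      then show ?thesis using L by (auto simp: less_Suc_eq)
    qed
  qed simp
  then obtain L where L: "\<And>i. i < I \<Longrightarrow> z i \<in> Q \<Longrightarrow> \<exists>b\<in>subtree n k L. z i \<in> tile b" by blast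
  define S where "S = subtree n k L"
  have S: "finite S" "S \<subseteq> boxes" using finite_subtree subtree_boxes[OF k] by (auto simp: S_def)
  define u where "u = ennreal ((1 / 2 ^ n) powr \<alpha>)"
  have "(\<Sum>i<I. indicator Q (z i) * ennreal ((1 - norm (z i)) powr \<alpha>))
      \<le> (\<Sum>i<I. \<Sum>b\<in>S. u * (ennreal (c b) * indicator (tile b) (z i)))"
  proof (rule sum_mono)
    fix i assume i: "i \<in> {..<I}"
    show "indicator Q (z i) * ennreal ((1 - norm (z i)) powr \<alpha>)
      \<le> (\<Sum>b\<in>S. u * (ennreal (c b) * indicator (tile b) (z i)))"
    proof (cases "z i \<in> Q")
      case True
      then obtain b where b: "b \<in> S" "z i \<in> tile b" using L[of i] i unfolding S_def by blast
      then have nb: "n \<le> fst b" "snd b < 2 ^ fst b"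
        using S by (auto simp: S_def subtree_def boxes_def)
      have zb: "0 \<le> 1 - norm (z i)" "1 - norm (z i) \<le> 1 / 2 ^ fst b"
        using b(2) dyadic_box_subset_disk[OF nb(2)] unfolding tile_def dyadic_box_iff[OF nb(2)]
        by (auto intro: order_trans[OF _ less_imp_le])
      then have "(1 - norm (z i)) powr \<alpha> \<le> (1 / 2 ^ fst b) powr \<alpha>" using \<alpha> by (intro powr_mono2) auto
      also have "(1::real) / 2 ^ fst b = 1 / 2 ^ n * (1 / 2 ^ (fst b - n))"
        using nb(1) by (simp flip: power_add)
      also have "\<dots> powr \<alpha> = (1 / 2 ^ n) powr \<alpha> * c b"
        unfolding c_def depth_weight_def by (rule powr_mult)
      finally have "ennreal ((1 - norm (z i)) powr \<alpha>) \<le> u * ennreal (c b)"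
        unfolding u_def by (subst ennreal_mult[symmetric]) (auto intro: ennreal_leI simp: c_def depth_weight_def)
      also have "\<dots> = u * (ennreal (c b) * indicator (tile b) (z i))" using b by simp
      also have "\<dots> \<le> (\<Sum>b\<in>S. u * (ennreal (c b) * indicator (tile b) (z i)))"
        using b S by (intro member_le_sum) auto
      finally show ?thesis using True by simp
    qed simp
  qed
  also have "\<dots> = (\<Sum>b\<in>S. u * (ennreal (c b) * (\<Sum>i<I. indicator (tile b) (z i))))"
    by (subst sum.swap) (simp only: sum_distrib_left)
  also have "\<dots> \<le> (\<Sum>b\<in>S. u * (ennreal (c b) * N b \<omega>))"
    unfolding N_eq_suminf z_def by (intro sum_mono mult_left_mono sum_le_suminf) auto
  also have "\<dots> = u * wsum c S \<omega>" by (simp add: wsum_def sum_distrib_left)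
  also have "\<dots> \<le> u * ennreal C" unfolding c_def S_def by (intro mult_left_mono le) auto
  also have "\<dots> = ennreal (C * (1 / 2 ^ n) powr \<alpha>)"
    using C by (simp add: u_def ennreal_mult mult.commute)
  finally show "(\<Sum>i<I. indicator (carleson_box (dyadic_arc n k)) (\<Lambda> \<omega> i) * ennreal ((1 - norm (\<Lambda> \<omega> i)) powr \<alpha>))
      \<le> ennreal (C * (1 / 2 ^ n) powr \<alpha>)"
    by (simp add: z_def Q_def)
qed simp

text \<open>The weight is a lower bound for (1 - \<open>norm z\<close>) powr \<alpha> on the box,
  and since the boxes are disjoint no point is counted twice.\<close>

lemma carleson_sum_ge:
  assumes \<alpha>: "0 < \<alpha>" and B: "finite B" "B \<subseteq> boxes" and Q: "\<And>b. b \<in> B \<Longrightarrow> tile b \<subseteq> Q"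
  shows "wsum (\<lambda>b. (1 / 2 ^ (fst b + 1)) powr \<alpha>) B \<omega> \<le> carleson_sum \<alpha> Q (\<Lambda> \<omega>)"
proof -
  define c where "c b = (1 / 2 ^ (fst b + 1)) powr \<alpha>" for b :: "nat \<times> nat"
  have "wsum c B \<omega> = (\<Sum>i. \<Sum>b\<in>B. ennreal (c b) * indicator (tile b) (\<Lambda> \<omega> i))"
    unfolding wsum_def N_eq_suminf by (simp add: suminf_sum)
  also have "\<dots> \<le> carleson_sum \<alpha> Q (\<Lambda> \<omega>)"
    unfolding carleson_sum_def
  proof (intro suminf_le)
    fix i
    let ?z = "\<Lambda> \<omega> i"
    show "(\<Sum>b\<in>B. ennreal (c b) * indicator (tile b) ?z) \<le> indicator Q ?z * ennreal ((1 - norm ?z) powr \<alpha>)"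
    proof (cases "\<exists>b\<in>B. ?z \<in> tile b")
      case True
      then obtain b where b: "b \<in> B" "?z \<in> tile b" by blast
      have uniq: "b' = b" if "b' \<in> B" "?z \<in> tile b'" for b'
      proof -
        have "snd b < 2 ^ fst b" "snd b' < 2 ^ fst b'" using b that B by (auto simp: boxes_def)
        then have "fst b = fst b' \<and> snd b = snd b'"
          using b that unfolding tile_def by (intro dyadic_box_unique)
        then show ?thesis by (simp add: prod_eq_iff)
      qed
      have "(\<Sum>b\<in>B. ennreal (c b) * indicator (tile b) ?z) = (\<Sum>b\<in>{b}. ennreal (c b) * indicator (tile b) ?z)"
      proof (rule sum.mono_neutral_right)
        have "?z \<notin> tile b'" if "b' \<in> B - {b}" for b' using uniq that by blast
        then show "\<forall>b\<in>B - {b}. ennreal (c b) * indicator (tile b) ?z = 0" by simp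
      qed (use b B in auto)
      also have "\<dots> = ennreal (c b)" using b by simp
      also have "\<dots> \<le> ennreal ((1 - norm ?z) powr \<alpha>)"
      proof (rule ennreal_leI)
        have "snd b < 2 ^ fst b" using b B by (auto simp: boxes_def)
        then have "1 / 2 ^ (fst b + 1) \<le> 1 - norm ?z"
          using b(2) unfolding tile_def by (subst (asm) dyadic_box_iff) auto
        then show "c b \<le> (1 - norm ?z) powr \<alpha>" unfolding c_def using \<alpha> by (intro powr_mono2) auto
      qed
      finally show ?thesis using b Q[of b] by (simp add: subset_iff)
    next
      case False
      then have "(\<Sum>b\<in>B. ennreal (c b) * indicator (tile b) ?z) = 0" by (intro sum.neutral) auto
      then show ?thesis by simp
    qed
  qed auto
  finally show ?thesis unfolding c_def[abs_def] .
qed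

text \<open>The definition quantifies over uncountably many arcs and constants; the dyadic form
  leaves countably many measurable conditions.\<close>

lemma carleson_measurable:
  assumes "0 < \<alpha>" shows "{\<omega> \<in> space M. carleson_sequence \<alpha> (\<Lambda> \<omega>)} \<in> events"
proof -
  have [measurable]: "(\<lambda>\<omega>. carleson_sum \<alpha> (carleson_box (dyadic_arc n k)) (\<Lambda> \<omega>)) \<in> borel_measurable M"
    if "k < 2 ^ n" for n k
  proof -
    have [measurable]: "carleson_box (dyadic_arc n k) \<in> sets borel" using that by (rule carleson_box_dyadic_borel)
    show ?thesis unfolding carleson_sum_def by measurable
  qed
  show ?thesis unfolding carleson_sequence_iff_dyadic[OF assms]
    by measurable
qed

text \<open>The weighted count of the whole tree below (n, k) exceeds C. The union is increasing in
  L, so bounds for finite trees pass to the limit.\<close>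

definition bad :: "real \<Rightarrow> nat \<Rightarrow> nat \<Rightarrow> real \<Rightarrow> 'w set" where
  "bad \<alpha> n k C = (\<Union>L. {\<omega> \<in> space M. ennreal C < wsum (depth_weight \<alpha> n) (subtree n k L) \<omega>})"

lemma bad_sets: "k < 2 ^ n \<Longrightarrow> bad \<alpha> n k C \<in> events"
  unfolding bad_def using subtree_boxes[of k n] by measurable

lemma prob_bad_le_exp:
  assumes k: "k < 2 ^ n" and \<alpha>: "0 \<le> \<alpha>" and t: "0 \<le> t" and C: "0 \<le> C"
    and \<epsilon>: "\<And>L. (\<Sum>b\<in>subtree n k L. depth_weight \<alpha> n b * w b) \<le> \<epsilon>"
  shows "prob (bad \<alpha> n k C) \<le> exp ((exp t - 1) * \<epsilon> - t * C)"
proof (rule LIMSEQ_le_const2)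
  let ?A = "\<lambda>L. {\<omega> \<in> space M. ennreal C < wsum (depth_weight \<alpha> n) (subtree n k L) \<omega>}"
  show "(\<lambda>L. prob (?A L)) \<longlonglongrightarrow> prob (bad \<alpha> n k C)"
    unfolding bad_def
  proof (rule finite_Lim_measure_incseq)
    show "range ?A \<subseteq> events" using subtree_boxes[OF k] by auto
    show "incseq ?A"
    proof (intro incseq_SucI Collect_mono impI conjI; elim conjE)
      fix L \<omega> assume "ennreal C < wsum (depth_weight \<alpha> n) (subtree n k L) \<omega>"
      also have "\<dots> \<le> wsum (depth_weight \<alpha> n) (subtree n k (Suc L)) \<omega>"
        unfolding wsum_def by (intro sum_mono2 finite_subtree subtree_mono) auto
      finally show "ennreal C < wsum (depth_weight \<alpha> n) (subtree n k (Suc L)) \<omega>" .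
    qed
  qed
  show "\<exists>N. \<forall>L\<ge>N. prob (?A L) \<le> exp ((exp t - 1) * \<epsilon> - t * C)"
    using finite_subtree subtree_boxes[OF k] depth_weight_bounds[OF \<alpha>] t C \<epsilon>
    by (intro exI allI impI prob_wsum_greater_le) auto
qed

text \<open>For 0 < \<epsilon> \<le> 1 the parameter t = - ln \<epsilon> makes the Chernoff exponent
  equal to 1 - \<epsilon> + p ln \<epsilon>. For \<epsilon> > 1 the right-hand side exceeds
  1.\<close>

lemma prob_bad_le_powr:
  assumes k: "k < 2 ^ n" and \<alpha>: "0 \<le> \<alpha>" and p: "0 < p" and \<epsilon>0: "0 \<le> \<epsilon>"
    and \<epsilon>: "\<And>L. (\<Sum>b\<in>subtree n k L. depth_weight \<alpha> n b * w b) \<le> \<epsilon>"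
  shows "prob (bad \<alpha> n k p) \<le> exp 1 * \<epsilon> powr p"
proof -
  consider "\<epsilon> = 0" | "0 < \<epsilon>" "\<epsilon> \<le> 1" | "1 < \<epsilon>" using \<epsilon>0 by linarith
  then show ?thesis
  proof cases
    case 1
    \<comment> \<open>No logarithm exists at \<epsilon> = 0, but then the mean term vanishes and t =
      - ln x / p gives the bound x for every x in (0, 1].\<close>
    have "prob (bad \<alpha> n k p) \<le> x" if x: "0 < x" for x
    proof (cases "x \<le> 1")
      case True
      have "prob (bad \<alpha> n k p) \<le> exp ((exp (- ln x / p) - 1) * \<epsilon> - (- ln x / p) * p)"
        using True x p by (intro prob_bad_le_exp[OF k \<alpha> _ _ \<epsilon>]) (auto simp: divide_nonpos_pos)
      then show ?thesis using x p 1 by simp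
    next
      case False
      then show ?thesis using prob_le_1[of "bad \<alpha> n k p"] by linarith
    qed
    then have "prob (bad \<alpha> n k p) \<le> 0" by (rule field_le_epsilon[of _ 0, simplified])
    then show ?thesis using 1 by simp
  next
    case 2
    have "prob (bad \<alpha> n k p) \<le> exp ((exp (- ln \<epsilon>) - 1) * \<epsilon> - (- ln \<epsilon>) * p)"
      using 2 p by (intro prob_bad_le_exp[OF k \<alpha> _ _ \<epsilon>]) auto
    also have "(exp (- ln \<epsilon>) - 1) * \<epsilon> \<le> 1" using 2 by (simp add: exp_minus field_simps)
    finally have "prob (bad \<alpha> n k p) \<le> exp (1 + p * ln \<epsilon>)" by (simp add: mult.commute)
    also have "\<dots> = exp 1 * \<epsilon> powr p" using 2 by (simp add: exp_add powr_def)
    finally show ?thesis .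
  next
    case 3
    have "prob (bad \<alpha> n k p) \<le> 1 * 1" by simp
    also have "\<dots> \<le> exp 1 * \<epsilon> powr p" using 3 p by (intro mult_mono) (auto simp: ge_one_powr_ge_zero)
    finally show ?thesis .
  qed
qed

text \<open>This serves the finitely many generations that Borel-Cantelli does not reach: the tail
  bound with t = 1 decays geometrically in C.\<close>

lemma AE_not_bad:
  assumes k: "k < 2 ^ n" and \<alpha>: "0 \<le> \<alpha>"
    and \<epsilon>: "\<And>L. (\<Sum>b\<in>subtree n k L. depth_weight \<alpha> n b * w b) \<le> \<epsilon>"
  shows "AE \<omega> in M. \<exists>C::nat. \<omega> \<notin> bad \<alpha> n k (real C)"
proof -
  define A where "A = (\<Inter>C::nat. bad \<alpha> n k (real C))"
  have A: "A \<in> events" unfolding A_def using bad_sets[OF k] by auto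
  have "prob A \<le> 0"
  proof (rule LIMSEQ_le_const)
    have "(\<lambda>C. exp ((exp 1 - 1) * \<epsilon>) * exp (- 1) ^ C) \<longlonglongrightarrow> exp ((exp 1 - 1) * \<epsilon>) * (0::real)"
      by (intro tendsto_mult tendsto_const LIMSEQ_power_zero) auto
    then show "(\<lambda>C. exp ((exp 1 - 1) * \<epsilon>) * exp (- 1) ^ C) \<longlonglongrightarrow> (0::real)" by simp
    have "prob A \<le> exp ((exp 1 - 1) * \<epsilon>) * exp (- 1) ^ C" for C
    proof -
      have "prob A \<le> prob (bad \<alpha> n k (real C))"
        using bad_sets[OF k] by (intro finite_measure_mono) (auto simp: A_def)
      also have "\<dots> \<le> exp ((exp 1 - 1) * \<epsilon> - 1 * real C)"
        by (intro prob_bad_le_exp[OF k \<alpha> _ _ \<epsilon>]) auto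
      also have "\<dots> = exp ((exp 1 - 1) * \<epsilon>) * exp (- 1) ^ C"
        by (simp add: exp_diff exp_minus divide_inverse power_inverse exp_of_nat_mult[of C 1, symmetric])
      finally show ?thesis .
    qed
    then show "\<exists>N. \<forall>C\<ge>N. prob A \<le> exp ((exp 1 - 1) * \<epsilon>) * exp (- 1) ^ C" by blast
  qed
  then have "A \<in> null_sets M" using A by (auto simp: emeasure_eq_measure measure_le_0_iff)
  then have "AE \<omega> in M. \<omega> \<notin> A" by (rule AE_not_in)
  then show ?thesis by eventually_elim (auto simp: A_def)
qed

text \<open>By Borel-Cantelli over generations, almost surely no box of a late generation exceeds
  the threshold p, and each of the remaining boxes has some finite threshold of its own.\<close>

lemma carleson_almost_surely:
  assumes \<alpha>: "0 < \<alpha>" and p: "0 < p" and \<epsilon>0: "\<And>n k. 0 \<le> \<epsilon> n k"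
    and \<epsilon>: "\<And>n k L. k < 2 ^ n \<Longrightarrow> (\<Sum>b\<in>subtree n k L. depth_weight \<alpha> n b * w b) \<le> \<epsilon> n k"
    and summ: "summable (\<lambda>n. \<Sum>k<2 ^ n. \<epsilon> n k powr p)"
  shows "carleson_with_prob M \<Lambda> \<alpha> 1"
proof -
  have [simp]: "0 \<le> \<alpha>" using \<alpha> by simp
  define A where "A n = (\<Union>k<2 ^ n. bad \<alpha> n k p)" for n
  have A: "A n \<in> events" for n unfolding A_def using bad_sets by auto
  have "prob (A n) \<le> exp 1 * (\<Sum>k<2 ^ n. \<epsilon> n k powr p)" for n
  proof -
    have "prob (A n) \<le> (\<Sum>k<2 ^ n. prob (bad \<alpha> n k p))"
      unfolding A_def using bad_sets by (intro finite_measure_subadditive_finite) auto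
    also have "\<dots> \<le> (\<Sum>k<2 ^ n. exp 1 * \<epsilon> n k powr p)"
      using p \<epsilon> \<epsilon>0 by (intro sum_mono prob_bad_le_powr) auto
    finally show ?thesis by (simp add: sum_distrib_left)
  qed
  then have "summable (\<lambda>n. prob (A n))"
    by (intro summable_comparison_test[OF _ summable_mult[OF summ, of "exp 1"]] exI[of _ 0]) simp
  then have "AE \<omega> in M. eventually (\<lambda>n. \<omega> \<in> space M - A n) sequentially"
    using A by (intro borel_cantelli_AE1) (auto simp: less_top[symmetric])
  moreover have "AE \<omega> in M. \<forall>n. \<forall>k\<in>{..<2 ^ n}. \<exists>C::nat. \<omega> \<notin> bad \<alpha> n k (real C)"
    using AE_not_bad[OF _ _ \<epsilon>] by (auto simp: AE_all_countable AE_finite_all)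
  ultimately have "AE \<omega> in M. carleson_sequence \<alpha> (\<Lambda> \<omega>)"
    using AE_space
  proof eventually_elim
    case (elim \<omega>)
    then obtain n0 where n0: "\<And>n. n \<ge> n0 \<Longrightarrow> \<omega> \<notin> A n" unfolding eventually_sequentially by blast
    obtain C :: "nat \<Rightarrow> nat \<Rightarrow> nat" where C: "\<And>n k. k < 2 ^ n \<Longrightarrow> \<omega> \<notin> bad \<alpha> n k (real (C n k))"
      using elim(2) by (metis lessThan_iff)
    \<comment> \<open>A sum in place of a maximum: it dominates p and all the individual thresholds
      of the early generations.\<close>
    define D where "D = nat \<lceil>p\<rceil> + (\<Sum>n<n0. \<Sum>k<2 ^ n. C n k)"
    have "wsum (depth_weight \<alpha> n) (subtree n k L) \<omega> \<le> ennreal (real D)" if k: "k < 2 ^ n" for n k L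
    proof (cases "n < n0")
      case True
      have "C n k \<le> (\<Sum>k<2 ^ n. C n k)" using k by (intro member_le_sum) auto
      also have "\<dots> \<le> (\<Sum>n<n0. \<Sum>k<2 ^ n. C n k)" using True by (intro member_le_sum) auto
      finally have "C n k \<le> D" by (simp add: D_def)
      then have "real (C n k) \<le> real D" by simp
      then have "ennreal (real (C n k)) \<le> ennreal (real D)" by (rule ennreal_leI)
      moreover have "\<not> ennreal (real (C n k)) < wsum (depth_weight \<alpha> n) (subtree n k L) \<omega>"
        using C[OF k] elim(3) by (auto simp: bad_def)
      ultimately show ?thesis by (meson not_less order_trans)
    next
      case False
      then have "\<omega> \<notin> bad \<alpha> n k p" using n0[of n] k by (auto simp: A_def)
      then have "\<not> ennreal p < wsum (depth_weight \<alpha> n) (subtree n k L) \<omega>" using elim(3) by (auto simp: bad_def)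
      moreover have "ennreal p \<le> ennreal (real D)"
      proof (rule ennreal_leI)
        have "p \<le> real (nat \<lceil>p\<rceil>)" by (rule real_nat_ceiling_ge)
        also have "\<dots> \<le> real D" by (simp add: D_def sum_nonneg del: of_nat_nat)
        finally show "p \<le> real D" .
      qed
      ultimately show ?thesis by (meson not_less order_trans)
    qed
    then have "\<forall>n. \<forall>k<2 ^ n. carleson_sum \<alpha> (carleson_box (dyadic_arc n k)) (\<Lambda> \<omega>) \<le> ennreal (real D * (1 / 2 ^ n) powr \<alpha>)"
      using \<alpha> by (intro allI impI carleson_sum_le) auto
    then show ?case unfolding carleson_sequence_iff_dyadic[OF \<alpha>] by blast
  qed
  then show ?thesis
    unfolding carleson_with_prob_def
    using carleson_measurable[OF \<alpha>] prob_Collect_eq_1[of "\<lambda>\<omega>. carleson_sequence \<alpha> (\<Lambda> \<omega>)"] by simp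
qed

lemma carleson_almost_never:
  assumes \<alpha>: "0 < \<alpha>" and "AE \<omega> in M. \<not> carleson_sequence \<alpha> (\<Lambda> \<omega>)"
  shows "carleson_with_prob M \<Lambda> \<alpha> 0"
  unfolding carleson_with_prob_def
  using carleson_measurable[OF \<alpha>] assms(2) prob_Collect_eq_0[of "\<lambda>\<omega>. carleson_sequence \<alpha> (\<Lambda> \<omega>)"] by simp

end

section \<open>The summability criterion\<close>

lemma Hoelder_sum:
  fixes a b :: "'a \<Rightarrow> real"
  assumes "finite I" and pq: "p > 1" "q > 1" "1 / p + 1 / q = 1"
    and a: "\<And>i. i \<in> I \<Longrightarrow> 0 \<le> a i" and b: "\<And>i. i \<in> I \<Longrightarrow> 0 \<le> b i"
  shows "(\<Sum>i\<in>I. a i * b i) \<le> (\<Sum>i\<in>I. a i powr p) powr (1 / p) * (\<Sum>i\<in>I. b i powr q) powr (1 / q)"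
proof -
  define A where "A = (\<Sum>i\<in>I. a i powr p)"
  define B where "B = (\<Sum>i\<in>I. b i powr q)"
  have AB: "0 \<le> A" "0 \<le> B" by (auto simp: A_def B_def sum_nonneg)
  show ?thesis
  proof (cases "A = 0 \<or> B = 0")
    case True
    then have "\<forall>i\<in>I. a i * b i = 0"
      using assms by (auto simp: A_def B_def sum_nonneg_eq_0_iff)
    then have "(\<Sum>i\<in>I. a i * b i) = 0" by (intro sum.neutral)
    then show ?thesis by simp
  next
    case False
    with AB have pos: "0 < A" "0 < B" by auto
    define s where "s = A powr (1 / p)"
    define t where "t = B powr (1 / q)"
    have st: "0 < s" "0 < t" "s powr p = A" "t powr q = B"
      using pos pq by (auto simp: s_def t_def powr_powr)
    have "(\<Sum>i\<in>I. a i / s * (b i / t)) \<le> (\<Sum>i\<in>I. a i powr p / (A * p) + b i powr q / (B * q))"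
    proof (rule sum_mono)
      fix i assume "i \<in> I"
      then have "a i / s * (b i / t) \<le> (a i / s) powr p / p + (b i / t) powr q / q"
        using pq a b st by (intro Youngs_inequality) auto
      then show "a i / s * (b i / t) \<le> a i powr p / (A * p) + b i powr q / (B * q)"
        using \<open>i \<in> I\<close> a b st by (simp add: powr_divide)
    qed
    also have "\<dots> = A / (A * p) + B / (B * q)"
      by (simp add: sum.distrib A_def B_def sum_divide_distrib)
    also have "\<dots> = 1" using pos pq by simp
    finally have "(\<Sum>i\<in>I. a i * b i) / (s * t) \<le> 1" by (simp add: sum_divide_distrib)
    then show ?thesis using st by (simp add: s_def t_def A_def B_def)
  qed
qed

lemma inverse_power_powr: "(1 / 2 ^ l) powr x = (2 powr - x :: real) ^ l"
proof -
  have "(1 / 2 ^ l :: real) = 2 powr - real l" by (simp add: powr_minus powr_realpow divide_inverse)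
  then have "(1 / 2 ^ l) powr x = 2 powr (- x * real l)" by (simp add: powr_powr mult.commute)
  also have "\<dots> = (2 powr - x) powr real l" by (simp only: powr_powr)
  also have "\<dots> = (2 powr - x) ^ l" by (rule powr_realpow) simp
  finally show ?thesis .
qed

lemma geometric_partial_le:
  fixes x :: real
  assumes "0 \<le> x" "x < 1" shows "(\<Sum>l<L. x ^ l) \<le> 1 / (1 - x)"
  using sum_le_suminf[of "\<lambda>l. x ^ l" "{..<L}"] assms by (simp add: suminf_geometric summable_geometric)

text \<open>Division by 2 ^ l with remainder: the trees rooted at generation n visit every box of
  generation n + l exactly once.\<close>

lemma sum_children: "(\<Sum>k<2 ^ n. \<Sum>i<2 ^ l. f (k * 2 ^ l + i)) = (\<Sum>j<2 ^ (n + l). f (j::nat) :: real)"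
proof -
  have "(\<Sum>k<2 ^ n. \<Sum>i<2 ^ l. f (k * 2 ^ l + i)) = (\<Sum>k<2 ^ n. sum f {k * 2 ^ l..<k * 2 ^ l + 2 ^ l})"
  proof (rule sum.cong[OF refl])
    fix k
    show "(\<Sum>i<2 ^ l. f (k * 2 ^ l + i)) = sum f {k * 2 ^ l..<k * 2 ^ l + 2 ^ l}"
      using sum.shift_bounds_nat_ivl[of f 0 "k * 2 ^ l" "2 ^ l"] by (simp add: lessThan_atLeast0 add.commute)
  qed
  also have "\<dots> = sum f {..<2 ^ n * 2 ^ l}" by (rule sum.nat_group)
  finally show ?thesis by (simp add: power_add)
qed

text \<open>Generation \<open>0\<close> is left out: the box \<open>(0, 0)\<close> contains the origin, which lies in no Carleson box.\<close>

definition levels :: "nat \<Rightarrow> (nat \<times> nat) set" where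
  "levels L = (SIGMA n:{1..<L}. {..<2 ^ n})"

lemma finite_levels: "finite (levels L)" and levels_boxes: "levels L \<subseteq> boxes"
  by (auto simp: levels_def boxes_def)

lemma sum_levels: "(\<Sum>b\<in>levels L. f b) = (\<Sum>n\<in>{1..<L}. \<Sum>k<2 ^ n. f (n, k))"
  unfolding levels_def by (simp add: sum.Sigma)

lemma partial_sums_unbounded:
  fixes f :: "nat \<Rightarrow> real"
  assumes "\<not> summable f" "\<And>n. 0 \<le> f n"
  shows "filterlim (\<lambda>L. \<Sum>n\<in>{1..<L}. f n) at_top sequentially"
proof -
  have "\<not> summable (\<lambda>n. f (Suc n))" using assms(1) by (simp add: summable_Suc_iff)
  show ?thesis unfolding filterlim_at_top
  proof
    fix Z
    have "\<exists>L. Z \<le> (\<Sum>n<L. f (Suc n))"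
    proof (rule ccontr)
      assume "\<nexists>L. Z \<le> (\<Sum>n<L. f (Suc n))"
      then have "summable (\<lambda>n. f (Suc n))"
        by (intro summableI_nonneg_bounded[of _ Z]) (auto simp: assms not_le intro: less_imp_le)
      with \<open>\<not> summable (\<lambda>n. f (Suc n))\<close> show False by blast
    qed
    then obtain L where "Z \<le> (\<Sum>n<L. f (Suc n))" by blast
    also have "\<dots> = (\<Sum>n\<in>{1..<Suc L}. f n)"
      by (simp add: sum.atLeast_Suc_lessThan_Suc_shift lessThan_atLeast0 del: sum.op_ivl_Suc)
    finally have L: "Z \<le> (\<Sum>n\<in>{1..<Suc L}. f n)" .
    have "Z \<le> (\<Sum>n\<in>{1..<L'}. f n)" if "Suc L \<le> L'" for L'
      using that by (intro order_trans[OF L] sum_mono2) (auto simp: assms)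
    then show "\<forall>\<^sub>F L in sequentially. Z \<le> (\<Sum>n\<in>{1..<L}. f n)"
      unfolding eventually_sequentially by blast
  qed
qed

lemma suminf_ennreal_finite_iff:
  fixes f :: "nat \<Rightarrow> real"
  assumes "\<And>n. 0 \<le> f n"
  shows "(\<Sum>n. ennreal (f n)) < \<infinity> \<longleftrightarrow> summable f"
proof
  assume "(\<Sum>n. ennreal (f n)) < \<infinity>"
  then show "summable f" using assms by (intro summable_suminf_not_top) (simp_all add: less_top)
next
  assume "summable f"
  then show "(\<Sum>n. ennreal (f n)) < \<infinity>"
    using ennreal_suminf_neq_top[OF _ assms] by (simp add: less_top[symmetric])
qed

section \<open>Convergent sums give Carleson sequences, divergent sums give crowded boxes\<close>

context poisson_process
begin

lemma dyadic_sum_finite_iff: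
  "dyadic_sum \<mu> \<gamma> < \<infinity> \<longleftrightarrow> summable (\<lambda>n. \<Sum>k<2 ^ n. w (n, k) powr \<gamma>)"
proof -
  have "dyadic_sum \<mu> \<gamma> = (\<Sum>n. ennreal (\<Sum>k<2 ^ n. w (n, k) powr \<gamma>))"
    by (simp add: dyadic_sum_def w_def tile_def sum_ennreal)
  then show ?thesis by (simp only:) (intro suminf_ennreal_finite_iff sum_nonneg, simp)
qed

text \<open>Raised to the power \<gamma>, the Hoelder bound for a tree is a multiple of its masses
  to the power \<gamma>, damped by \<beta> ^ l. Summing over k restores whole generations, and
  summing over n costs only the factor 1 / (1 - \<beta>).\<close>

lemma carleson_if_dyadic_sum_finite:
  assumes \<alpha>: "0 < \<alpha>" "\<alpha> \<le> 1" and \<gamma>: "1 < \<gamma>" "\<gamma> * (1 - \<alpha>) < 1" and fin: "dyadic_sum \<mu> \<gamma> < \<infinity>"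
  shows "carleson_with_prob M \<Lambda> \<alpha> 1"
proof -
  define a where "a m = (\<Sum>j<2 ^ m. w (m, j) powr \<gamma>)" for m
  have a: "summable a" using fin unfolding dyadic_sum_finite_iff a_def[abs_def] .
  have a0: "0 \<le> a m" for m by (simp add: a_def sum_nonneg)
  define q where "q = \<gamma> / (\<gamma> - 1)"
  \<comment> \<open>The midpoint between 1 / q and \<alpha>; the hypothesis on \<gamma> says that
    this gap is nonempty.\<close>
  define \<tau> where "\<tau> = (1 / q + \<alpha>) / 2"
  have q: "1 < q" "1 / q + 1 / \<gamma> = 1" using \<gamma> by (simp_all add: q_def diff_divide_distrib)
  have "1 - 1 / \<gamma> < \<alpha>" using \<gamma> by (simp add: field_simps)
  then have "1 / q < \<alpha>" using q by linarith
  then have \<tau>: "1 / q < \<tau>" "\<tau> < \<alpha>" by (auto simp: \<tau>_def)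
  then have \<tau>q: "1 < \<tau> * q" using q(1) by (simp add: field_simps)
  \<comment> \<open>\<rho> is the ratio of the q-sum over 2 ^ l boxes, less than 1 since \<tau> > 1
    / q; \<beta> is the remaining weight per level to the power \<gamma>, less than 1 since \<tau> <
    \<alpha>.\<close>
  define \<rho> where "\<rho> = (2::real) powr (1 - \<tau> * q)"
  define \<beta> where "\<beta> = (2::real) powr - ((\<alpha> - \<tau>) * \<gamma>)"
  have "2 powr (1 - \<tau> * q) < (2::real) powr 0" using \<tau>q by (intro powr_less_mono) auto
  then have \<rho>: "0 \<le> \<rho>" "\<rho> < 1" by (auto simp: \<rho>_def)
  have "2 powr - ((\<alpha> - \<tau>) * \<gamma>) < (2::real) powr 0" using \<tau> \<gamma> by (intro powr_less_mono) auto
  then have \<beta>: "0 \<le> \<beta>" "\<beta> < 1" by (auto simp: \<beta>_def)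
  define r where "r n k l = \<beta> ^ l * (\<Sum>i<2 ^ l. w (n + l, k * 2 ^ l + i) powr \<gamma>)" for n k l
  have r0: "0 \<le> r n k l" for n k l using \<beta> by (simp add: r_def sum_nonneg)
  have sum_r: "(\<Sum>k<2 ^ n. r n k l) = \<beta> ^ l * a (n + l)" for n l
    unfolding r_def a_def sum_distrib_left[symmetric]
    using sum_children[where f = "\<lambda>j. w (n + l, j) powr \<gamma>"] by simp
  have summ_b: "summable (\<lambda>l. \<beta> ^ l * a (n + l))" for n
  proof (rule summable_comparison_test')
    show "summable (\<lambda>l. a (n + l))" using summable_ignore_initial_segment[OF a, of n] by (simp add: add.commute)
    show "norm (\<beta> ^ l * a (n + l)) \<le> a (n + l)" if "0 \<le> l" for l
      using \<beta> a0 mult_right_mono[of "\<beta> ^ l" 1 "a (n + l)"] by (simp add: power_le_one)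
  qed
  have summ_r: "summable (r n k)" if "k < 2 ^ n" for n k
  proof (rule summable_comparison_test'[OF summ_b[of n]])
    show "norm (r n k l) \<le> \<beta> ^ l * a (n + l)" if "0 \<le> l" for l
      unfolding sum_r[symmetric] using r0 \<open>k < 2 ^ n\<close> member_le_sum[of k "{..<2 ^ n}" "\<lambda>k. r n k l"] by simp
  qed
  define K where "K = 1 / (1 - \<rho>)"
  have K: "0 < K" using \<rho> by (simp add: K_def)
  define \<epsilon> where "\<epsilon> n k = K powr (1 / q) * (if k < 2 ^ n then suminf (r n k) else 0) powr (1 / \<gamma>)" for n k
  show ?thesis
  proof (rule carleson_almost_surely)
    show "0 < \<alpha>" "0 < \<gamma>" using \<alpha> \<gamma> by auto
    show "0 \<le> \<epsilon> n k" for n k by (simp add: \<epsilon>_def)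
    show "(\<Sum>b\<in>subtree n k L. depth_weight \<alpha> n b * w b) \<le> \<epsilon> n k" if k: "k < 2 ^ n" for n k L
    proof -
      define u where "u b = (1 / 2 ^ (fst b - n)) powr \<tau>" for b :: "nat \<times> nat"
      define v where "v b = (1 / 2 ^ (fst b - n)) powr (\<alpha> - \<tau>) * w b" for b :: "nat \<times> nat"
      have "(\<Sum>b\<in>subtree n k L. depth_weight \<alpha> n b * w b) = (\<Sum>b\<in>subtree n k L. u b * v b)"
        by (intro sum.cong refl) (simp add: u_def v_def depth_weight_def flip: powr_add)
      also have "\<dots> \<le> (\<Sum>b\<in>subtree n k L. u b powr q) powr (1 / q) * (\<Sum>b\<in>subtree n k L. v b powr \<gamma>) powr (1 / \<gamma>)"
        using q \<gamma> w_nonneg by (intro Hoelder_sum finite_subtree) (auto simp: u_def v_def)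
      also have "(\<Sum>b\<in>subtree n k L. u b powr q) = (\<Sum>l<L. \<rho> ^ l)"
      proof -
        have "u (n + l, j) powr q = (2 powr - (\<tau> * q)) ^ l" for l j
          unfolding u_def powr_powr by (simp add: inverse_power_powr)
        moreover have "2 ^ l * (2 powr - (\<tau> * q)) ^ l = \<rho> ^ l" for l
          by (simp add: \<rho>_def powr_diff powr_minus divide_inverse power_mult_distrib)
        ultimately show ?thesis by (simp add: sum_subtree)
      qed
      also have "(\<Sum>b\<in>subtree n k L. v b powr \<gamma>) = (\<Sum>l<L. r n k l)"
      proof -
        have "v (n + l, j) powr \<gamma> = \<beta> ^ l * w (n + l, j) powr \<gamma>" for l j
          unfolding v_def powr_mult powr_powr by (simp add: inverse_power_powr \<beta>_def)
        then show ?thesis by (simp add: sum_subtree r_def sum_distrib_left)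
      qed
      also have "(\<Sum>l<L. \<rho> ^ l) powr (1 / q) * (\<Sum>l<L. r n k l) powr (1 / \<gamma>) \<le> \<epsilon> n k"
      proof -
        have "(\<Sum>l<L. \<rho> ^ l) powr (1 / q) \<le> K powr (1 / q)"
          unfolding K_def using q \<rho> by (intro powr_mono2 geometric_partial_le sum_nonneg) auto
        moreover have "(\<Sum>l<L. r n k l) powr (1 / \<gamma>) \<le> suminf (r n k) powr (1 / \<gamma>)"
          using \<gamma> r0 summ_r[OF k] by (intro powr_mono2 sum_le_suminf sum_nonneg) auto
        ultimately show ?thesis unfolding \<epsilon>_def using k by (auto intro!: mult_mono)
      qed
      finally show ?thesis .
    qed
    have sum_\<epsilon>: "(\<Sum>k<2 ^ n. \<epsilon> n k powr \<gamma>) = K powr (\<gamma> / q) * (\<Sum>l. \<beta> ^ l * a (n + l))" for n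
    proof -
      have "(\<Sum>k<2 ^ n. \<epsilon> n k powr \<gamma>) = (\<Sum>k<2 ^ n. K powr (\<gamma> / q) * suminf (r n k))"
        using \<gamma> r0 summ_r by (intro sum.cong refl) (simp add: \<epsilon>_def powr_mult powr_powr suminf_nonneg)
      also have "\<dots> = K powr (\<gamma> / q) * (\<Sum>l. \<Sum>k<2 ^ n. r n k l)"
        using summ_r by (subst suminf_sum) (auto simp: sum_distrib_left)
      finally show ?thesis by (simp only: sum_r)
    qed
    have "summable (\<lambda>n. \<Sum>l. \<beta> ^ l * a (n + l))"
    proof (rule summableI_nonneg_bounded)
      show "0 \<le> (\<Sum>l. \<beta> ^ l * a (n + l))" for n using \<beta> a0 summ_b by (intro suminf_nonneg) auto
      have S: "(\<lambda>l. \<beta> ^ l * suminf a) sums (1 / (1 - \<beta>) * suminf a)"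
        using \<beta> by (intro sums_mult2 geometric_sums) auto
      show "(\<Sum>n<m. \<Sum>l. \<beta> ^ l * a (n + l)) \<le> 1 / (1 - \<beta>) * suminf a" for m
      proof -
        \<comment> \<open>After the interchange, the sum over n for fixed l runs over distinct
          generations and is at most \<open>suminf a\<close>.\<close>
        have "(\<Sum>n<m. \<Sum>l. \<beta> ^ l * a (n + l)) = (\<Sum>l. \<Sum>n<m. \<beta> ^ l * a (n + l))"
          using summ_b by (simp add: suminf_sum)
        also have "\<dots> \<le> (\<Sum>l. \<beta> ^ l * suminf a)"
        proof (rule suminf_le)
          fix l
          have "(\<Sum>n<m. a (n + l)) = (\<Sum>n\<in>{l..<m + l}. a n)"
            using sum.shift_bounds_nat_ivl[of a 0 l m] by (simp add: lessThan_atLeast0)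
          also have "\<dots> \<le> suminf a" using a a0 by (intro sum_le_suminf) auto
          finally show "(\<Sum>n<m. \<beta> ^ l * a (n + l)) \<le> \<beta> ^ l * suminf a"
            using \<beta> by (simp add: sum_distrib_left[symmetric] mult_left_mono)
        qed (use S sums_summable summ_b in \<open>auto intro!: summable_sum\<close>)
        also have "\<dots> = 1 / (1 - \<beta>) * suminf a" using S sums_unique by metis
        finally show ?thesis .
      qed
    qed
    then show "summable (\<lambda>n. \<Sum>k<2 ^ n. \<epsilon> n k powr \<gamma>)" unfolding sum_\<epsilon> by (rule summable_mult)
  qed
qed

text \<open>In the manner of the second Borel-Cantelli lemma: the probability that no box of
  generations 1 to L - 1 holds K points is at most exp of minus a multiple of a divergent partial
  sum.\<close>

lemma AE_ex_N_ge:
  assumes div: "dyadic_sum \<mu> (real K) = \<infinity>" and K: "0 < K"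
  shows "AE \<omega> in M. \<exists>b\<in>boxes. 1 \<le> fst b \<and> of_nat K \<le> N b \<omega>"
proof -
  define c where "c n = (\<Sum>j<2 ^ n. min (w (n, j)) 1 ^ K)" for n
  have c0: "0 \<le> c n" for n using w_nonneg by (simp add: c_def sum_nonneg)
  \<comment> \<open>Truncation at 1 cannot create convergence: summability would push the masses
    below 1 from some generation on, where truncated and full powers agree.\<close>
  have "\<not> summable c"
  proof
    assume c: "summable c"
    then have "c \<longlonglongrightarrow> 0" by (rule summable_LIMSEQ_zero)
    then have "\<forall>\<^sub>F n in sequentially. c n < 1" by (rule order_tendstoD) simp
    then have "\<forall>\<^sub>F n in sequentially. c n = (\<Sum>j<2 ^ n. w (n, j) powr real K)"
    proof eventually_elim
      case (elim n)
      have "min (w (n, j)) 1 ^ K = w (n, j) powr real K" if j: "j < 2 ^ n" for j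
      proof -
        have "min (w (n, j)) 1 ^ K \<le> c n"
          unfolding c_def using j w_nonneg by (intro member_le_sum) auto
        with elim have "min (w (n, j)) 1 ^ K < 1" by linarith
        then have "w (n, j) < 1" by (intro ccontr[of "w (n, j) < 1"]) (simp add: min_absorb2)
        then show ?thesis using w_nonneg[of "(n, j)"] K by (simp add: powr_realpow')
      qed
      then show ?case by (simp add: c_def)
    qed
    then have "summable (\<lambda>n. \<Sum>j<2 ^ n. w (n, j) powr real K)"
      using c summable_cong[of c "\<lambda>n. \<Sum>j<2 ^ n. w (n, j) powr real K"] by blast
    then have "dyadic_sum \<mu> (real K) < \<infinity>" unfolding dyadic_sum_finite_iff .
    with div show False by simp
  qed
  then have lim: "filterlim (\<lambda>L. \<Sum>n\<in>{1..<L}. c n) at_top sequentially"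
    using c0 by (rule partial_sums_unbounded)
  define A where "A L = {\<omega> \<in> space M. \<forall>b\<in>levels L. N b \<omega> < of_nat K}" for L
  have A: "A L \<in> events" for L
    unfolding A_def
  proof (rule sets.sets_Collect_finite_All[OF _ finite_levels])
    fix b assume "b \<in> levels L"
    then have [measurable]: "N b \<in> borel_measurable M" using levels_boxes by (intro N_measurable) auto
    show "{\<omega> \<in> space M. N b \<omega> < of_nat K} \<in> events" by measurable
  qed
  define d :: real where "d = 1 / (2 * fact (2 * K))"
  have d: "0 < d" by (simp add: d_def)
  have "prob (\<Inter>L. A L) \<le> 0"
  proof (rule LIMSEQ_le_const)
    have "filterlim (\<lambda>L. d * (\<Sum>n\<in>{1..<L}. c n)) at_top sequentially"
      using lim d by (intro filterlim_tendsto_pos_mult_at_top[OF tendsto_const]) auto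
    then show "(\<lambda>L. exp (- (d * (\<Sum>n\<in>{1..<L}. c n)))) \<longlonglongrightarrow> 0"
      by (intro filterlim_compose[OF exp_at_bot]) (simp add: filterlim_uminus_at_top[symmetric] filterlim_uminus_at_bot)
    have "prob (\<Inter>L. A L) \<le> exp (- (d * (\<Sum>n\<in>{1..<L}. c n)))" for L
    proof -
      have "prob (\<Inter>L. A L) \<le> prob (A L)" using A by (intro finite_measure_mono) auto
      also have "\<dots> \<le> exp (- (\<Sum>b\<in>levels L. min (w b) 1 ^ K / (2 * fact (2 * K))))"
        unfolding A_def by (rule prob_all_N_less_le[OF finite_levels levels_boxes])
      also have "\<dots> = exp (- (d * (\<Sum>n\<in>{1..<L}. c n)))"
        by (simp add: sum_levels c_def d_def sum_divide_distrib)
      finally show ?thesis .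
    qed
    then show "\<exists>N. \<forall>L\<ge>N. prob (\<Inter>L. A L) \<le> exp (- (d * (\<Sum>n\<in>{1..<L}. c n)))" by blast
  qed
  then have "(\<Inter>L. A L) \<in> null_sets M" using A by (auto simp: emeasure_eq_measure measure_le_0_iff)
  then have "AE \<omega> in M. \<omega> \<notin> (\<Inter>L. A L)" by (rule AE_not_in)
  then show ?thesis using AE_space
  proof eventually_elim
    case (elim \<omega>)
    then obtain L b where "b \<in> levels L" "\<not> N b \<omega> < of_nat K" by (auto simp: A_def)
    then show ?case using levels_boxes[of L] by (intro bexI[of _ b]) (auto simp: levels_def)
  qed
qed

lemma not_carleson_if_dyadic_sum_infinite:
  assumes div: "\<And>\<gamma>. 1 < \<gamma> \<Longrightarrow> dyadic_sum \<mu> \<gamma> = \<infinity>"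
  shows "carleson_with_prob M \<Lambda> 1 0"
proof (rule carleson_almost_never)
  \<comment> \<open>The shift by 2 keeps the exponent above 1, so that the divergence hypothesis
    applies for every natural K.\<close>
  have "AE \<omega> in M. \<exists>b\<in>boxes. 1 \<le> fst b \<and> of_nat (K + 2) \<le> N b \<omega>" for K
    by (intro AE_ex_N_ge div) auto
  then have "AE \<omega> in M. \<forall>K. \<exists>b\<in>boxes. 1 \<le> fst b \<and> of_nat (K + 2) \<le> N b \<omega>"
    by (simp add: AE_all_countable)
  then show "AE \<omega> in M. \<not> carleson_sequence 1 (\<Lambda> \<omega>)"
  proof eventually_elim
    case (elim \<omega>)
    show ?case
    proof
      assume "carleson_sequence 1 (\<Lambda> \<omega>)"
      then obtain C :: nat where C: "\<And>n k. k < 2 ^ n \<Longrightarrow>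
          carleson_sum 1 (carleson_box (dyadic_arc n k)) (\<Lambda> \<omega>) \<le> ennreal (real C * (1 / 2 ^ n) powr 1)"
        unfolding carleson_sequence_iff_dyadic[OF zero_less_one] by blast
      \<comment> \<open>Each point of this box weighs at least 1 / 2 ^ (n + 2), so 4 C points
        exhaust the bound C / 2 ^ n for the parent arc and two more exceed it.\<close>
      obtain n j where b: "(Suc n, j) \<in> boxes" "of_nat (4 * C + 2) \<le> N (Suc n, j) \<omega>"
        using elim[rule_format, of "4 * C"] by (metis One_nat_def Suc_le_D prod.collapse)
      have j: "j < 2 ^ Suc n" using b(1) by (simp add: boxes_def)
      then have j2: "j div 2 < 2 ^ n" by auto
      have "ennreal (1 / 2 ^ (Suc n + 1)) * of_nat (4 * C + 2) \<le> ennreal (1 / 2 ^ (Suc n + 1)) * N (Suc n, j) \<omega>"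
        using b(2) by (intro mult_left_mono) auto
      also have "\<dots> = wsum (\<lambda>b. (1 / 2 ^ (fst b + 1)) powr 1) {(Suc n, j)} \<omega>"
        by (simp add: wsum_def)
      also have "\<dots> \<le> carleson_sum 1 (carleson_box (dyadic_arc n (j div 2))) (\<Lambda> \<omega>)"
        using b(1) dyadic_box_subset_parent[OF j] by (intro carleson_sum_ge) (auto simp: tile_def)
      also have "\<dots> \<le> ennreal (real C * (1 / 2 ^ n) powr 1)" by (rule C[OF j2])
      finally have "ennreal (1 / 2 ^ (Suc n + 1) * real (4 * C + 2)) \<le> ennreal (real C * (1 / 2 ^ n) powr 1)"
        unfolding ennreal_of_nat_eq_real_of_nat by (subst ennreal_mult) simp_all
      then have "1 / 2 ^ (Suc n + 1) * real (4 * C + 2) \<le> real C * (1 / 2 ^ n)"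
        by (subst (asm) ennreal_le_iff) auto
      moreover have "1 / 2 ^ (Suc n + 1) * real (4 * C + 2) = real C * (1 / 2 ^ n) + 1 / 2 ^ (n + 1)"
        by (simp add: field_simps)
      moreover have "0 < (1::real) / 2 ^ (n + 1)" by simp
      ultimately show False by linarith
    qed
  qed
qed simp

end

section \<open>Atomic intensity measures\<close>

text \<open>The inner corner at the initial angle, which the non-strict inequalities of
  \<open>dyadic_box\<close> include; for (0, 0) it is the origin.\<close>

definition tile_corner :: "nat \<times> nat \<Rightarrow> complex" where
  "tile_corner b = rcis (1 - 1 / 2 ^ fst b) (2 * pi * (real (snd b) / 2 ^ fst b))"

text \<open>A sum of point masses, written as a push-forward so that the target \<sigma>-algebra is
  the required one by construction.\<close>

definition atomic_measure :: "(nat \<times> nat \<Rightarrow> real) \<Rightarrow> complex measure" where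
  "atomic_measure v =
     distr (density (count_space boxes) (\<lambda>b. ennreal (v b))) (restrict_space borel unit_disk) tile_corner"

lemma norm_tile_corner: "norm (tile_corner b) = 1 - 1 / 2 ^ fst b"
  by (simp add: tile_corner_def)

lemma tile_corner_disk: "tile_corner b \<in> unit_disk"
  by (simp add: norm_tile_corner)

lemma tile_corner_in_dyadic_box:
  assumes "b \<in> boxes" shows "tile_corner b \<in> dyadic_box (fst b) (snd b)"
proof -
  have "real (snd b) / 2 ^ fst b < real (snd b + 1) / 2 ^ fst b" by (simp add: divide_strict_right_mono)
  moreover have "(1::real) / 2 ^ (fst b + 1) < 1 / 2 ^ fst b" by (simp add: field_simps)
  ultimately show ?thesis unfolding dyadic_box_def tile_corner_def
    by (intro CollectI exI[of _ "1 - 1 / 2 ^ fst b"] exI[of _ "2 * pi * (real (snd b) / 2 ^ fst b)"]) auto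
qed

lemma tile_corner_in_dyadic_box_iff:
  assumes "b \<in> boxes" "(n, k) \<in> boxes"
  shows "tile_corner b \<in> dyadic_box n k \<longleftrightarrow> b = (n, k)"
  using tile_corner_in_dyadic_box[OF assms(1)] dyadic_box_unique[of "tile_corner b" "fst b" "snd b" n k] assms
  by (auto simp: boxes_def)

lemma tile_corner_measurable: "tile_corner \<in> count_space boxes \<rightarrow>\<^sub>M restrict_space borel unit_disk"
  by (auto simp: space_restrict_space norm_tile_corner)

lemma sets_atomic_measure: "sets (atomic_measure v) = sets (restrict_space borel unit_disk)"
  by (simp add: atomic_measure_def)

lemma emeasure_atomic_measure:
  assumes "A \<in> sets (restrict_space borel unit_disk)"
  shows "emeasure (atomic_measure v) A = (\<integral>\<^sup>+b. ennreal (v b) * indicator A (tile_corner b) \<partial>count_space boxes)"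
proof -
  have "emeasure (atomic_measure v) A =
      emeasure (density (count_space boxes) (\<lambda>b. ennreal (v b))) (tile_corner -` A \<inter> boxes)"
    unfolding atomic_measure_def using assms tile_corner_measurable by (subst emeasure_distr) auto
  also have "\<dots> = (\<integral>\<^sup>+b. ennreal (v b) * indicator (tile_corner -` A \<inter> boxes) b \<partial>count_space boxes)"
    by (subst emeasure_density) auto
  also have "\<dots> = (\<integral>\<^sup>+b. ennreal (v b) * indicator A (tile_corner b) \<partial>count_space boxes)"
    by (intro nn_integral_cong) (auto simp: indicator_def)
  finally show ?thesis .
qed

lemma emeasure_atomic_measure_finite:
  assumes A: "A \<in> sets (restrict_space borel unit_disk)" and F: "finite F" "F \<subseteq> boxes"
    and out: "\<And>b. b \<in> boxes \<Longrightarrow> tile_corner b \<in> A \<Longrightarrow> b \<in> F"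
  shows "emeasure (atomic_measure v) A = (\<Sum>b\<in>F. ennreal (v b) * indicator A (tile_corner b))"
  unfolding emeasure_atomic_measure[OF A] using F out
  by (intro nn_integral_count_space') (auto simp: indicator_def)

lemma measure_atomic_measure_dyadic_box:
  assumes b: "(n, k) \<in> boxes" and v: "0 \<le> v (n, k)"
  shows "measure (atomic_measure v) (dyadic_box n k) = v (n, k)"
proof -
  have "dyadic_box n k \<in> sets (restrict_space borel unit_disk)"
    using b dyadic_box_borel[of k n] dyadic_box_subset_disk[of k n]
    by (simp add: boxes_def sets_restrict_space_iff)
  then have "emeasure (atomic_measure v) (dyadic_box n k) =
      (\<Sum>b\<in>{(n, k)}. ennreal (v b) * indicator (dyadic_box n k) (tile_corner b))"
    using b tile_corner_in_dyadic_box_iff by (intro emeasure_atomic_measure_finite) auto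
  also have "\<dots> = ennreal (v (n, k))" using tile_corner_in_dyadic_box[OF b] by simp
  finally show ?thesis using v by (simp add: measure_def)
qed

text \<open>The corners accumulate only at the unit circle, so the ball meets finitely many
  generations.\<close>

lemma emeasure_atomic_measure_cball:
  assumes "r < 1" shows "emeasure (atomic_measure v) (cball 0 r) < \<infinity>"
proof -
  obtain m where m: "(1 / 2) ^ m < 1 - r" using real_arch_pow_inv[of "1 - r" "1/2"] assms by auto
  define F where "F = (SIGMA n:{..<m}. {..<(2::nat) ^ n})"
  have "emeasure (atomic_measure v) (cball 0 r) = (\<Sum>b\<in>F. ennreal (v b) * indicator (cball 0 r) (tile_corner b))"
  proof (rule emeasure_atomic_measure_finite)
    have "cball 0 r \<subseteq> unit_disk" using assms by auto
    then show "cball 0 r \<in> sets (restrict_space borel unit_disk)" by (simp add: sets_restrict_space_iff)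
    show "finite F" "F \<subseteq> boxes" by (auto simp: F_def boxes_def)
    fix b assume b: "b \<in> boxes" "tile_corner b \<in> cball 0 r"
    have "fst b < m"
    proof (rule ccontr)
      assume "\<not> fst b < m"
      then have "(1 / 2) ^ fst b \<le> (1 / 2 :: real) ^ m" by (intro power_decreasing) auto
      moreover have "1 - (1 / 2) ^ fst b \<le> r" using b(2) norm_tile_corner[of b] by (simp add: power_one_over)
      ultimately show False using m by linarith
    qed
    then show "b \<in> F" using b(1) by (auto simp: F_def boxes_def)
  qed
  also have "\<dots> < \<infinity>" by (auto simp: F_def ennreal_mult_less_top indicator_def)
  finally show ?thesis .
qed

lemma compact_in_disk_subset_cball:
  assumes "compact K" "K \<subseteq> unit_disk" obtains r where "r < 1" "K \<subseteq> cball (0::complex) r"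
proof (cases "K = {}")
  case False
  have "continuous_on K norm" by (intro continuous_intros)
  then obtain x where "x \<in> K" "\<And>y. y \<in> K \<Longrightarrow> norm y \<le> norm x"
    using continuous_attains_sup[OF assms(1) False, of norm] by blast
  then show ?thesis using assms(2) by (intro that[of "norm x"]) auto
qed (use that[of 0] in auto)

lemma intensity_measure_atomic_measure:
  assumes v: "\<And>b. 0 \<le> v b" and div: "\<not> summable (\<lambda>n. \<Sum>k<2 ^ n. v (n, k))"
  shows "intensity_measure (atomic_measure v)"
  unfolding intensity_measure_def
proof (intro conjI allI impI)
  let ?\<mu> = "atomic_measure v"
  show "sets ?\<mu> = sets (restrict_space borel unit_disk)" by (rule sets_atomic_measure)
  then have sp: "space ?\<mu> = unit_disk" using sets_eq_imp_space_eq[of ?\<mu>] by (simp add: space_restrict_space)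
  have cball_sets: "cball 0 r \<in> sets ?\<mu>" if "r < 1" for r
  proof -
    have "cball 0 r \<subseteq> unit_disk" using that by auto
    then show ?thesis by (simp add: sets_atomic_measure sets_restrict_space_iff)
  qed
  show "emeasure ?\<mu> K < \<infinity>" if "compact K \<and> K \<subseteq> unit_disk" for K
  proof -
    from that have K: "compact K" "K \<subseteq> unit_disk" by auto
    from compact_in_disk_subset_cball[OF K] obtain r where r: "r < 1" "K \<subseteq> cball 0 r" .

    have "emeasure ?\<mu> K \<le> emeasure ?\<mu> (cball 0 r)" using r cball_sets by (intro emeasure_mono)
    also have "\<dots> < \<infinity>" by (rule emeasure_atomic_measure_cball[OF r(1)])
    finally show ?thesis .
  qed
  show "sigma_finite_measure ?\<mu>"
  proof
    show "\<exists>A. countable A \<and> A \<subseteq> sets ?\<mu> \<and> \<Union>A = space ?\<mu> \<and> (\<forall>a\<in>A. emeasure ?\<mu> a \<noteq> \<infinity>)"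
    proof (intro exI[of _ "range (\<lambda>n. cball 0 (1 - 1 / 2 ^ n))"] conjI)
      show "range (\<lambda>n. cball 0 (1 - 1 / 2 ^ n)) \<subseteq> sets ?\<mu>" using cball_sets by auto
      show "(\<Union>n. cball 0 (1 - 1 / 2 ^ n)) = space ?\<mu>"
        unfolding sp
      proof (intro set_eqI iffI)
        fix z :: complex assume "z \<in> unit_disk"
        then obtain n where "1 / 2 ^ (n + 1) < 1 - norm z" using ex_dyadic_level[of "1 - norm z"] by auto
        then have "z \<in> cball 0 (1 - 1 / 2 ^ (n + 1))" by simp
        then show "z \<in> (\<Union>n. cball 0 (1 - 1 / 2 ^ n))" by blast
      next
        fix z :: complex assume "z \<in> (\<Union>n. cball 0 (1 - 1 / 2 ^ n))"
        then obtain n :: nat where "norm z \<le> 1 - 1 / 2 ^ n" by auto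
        moreover have "0 < (1::real) / 2 ^ n" by simp
        ultimately have "norm z < 1" by linarith
        then show "z \<in> unit_disk" by simp
      qed
      show "\<forall>a\<in>range (\<lambda>n. cball 0 (1 - 1 / 2 ^ n)). emeasure ?\<mu> a \<noteq> \<infinity>"
        using emeasure_atomic_measure_cball[of "1 - 1 / 2 ^ n" v for n] by (auto simp: less_top)
    qed auto
  qed
  have "unit_disk \<in> sets (restrict_space borel unit_disk)" by (simp add: sets_restrict_space_iff)
  then have "emeasure ?\<mu> unit_disk = (\<integral>\<^sup>+b. ennreal (v b) * indicator unit_disk (tile_corner b) \<partial>count_space boxes)"
    by (rule emeasure_atomic_measure)
  also have "\<dots> = (\<integral>\<^sup>+b. ennreal (v b) \<partial>count_space boxes)"
    using tile_corner_disk by (intro nn_integral_cong) (simp del: mem_ball)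
  finally have E: "emeasure ?\<mu> unit_disk = (\<integral>\<^sup>+b. ennreal (v b) \<partial>count_space boxes)" .
  show "emeasure ?\<mu> unit_disk = \<infinity>"
  proof (rule ccontr)
    assume "emeasure ?\<mu> unit_disk \<noteq> \<infinity>"
    then obtain x where x: "0 \<le> x" "(\<integral>\<^sup>+b. ennreal (v b) \<partial>count_space boxes) = ennreal x"
      unfolding E by (cases "(\<integral>\<^sup>+b. ennreal (v b) \<partial>count_space boxes)") auto
    have "summable (\<lambda>n. \<Sum>k<2 ^ n. v (n, k))"
    proof (rule summableI_nonneg_bounded)
      show "0 \<le> (\<Sum>k<2 ^ n. v (n, k))" for n using v by (simp add: sum_nonneg)
      fix m
      define F where "F = (SIGMA n:{..<m}. {..<(2::nat) ^ n})"
      have F: "finite F" "F \<subseteq> boxes" by (auto simp: F_def boxes_def)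
      have "ennreal (\<Sum>n<m. \<Sum>k<2 ^ n. v (n, k)) = ennreal (\<Sum>b\<in>F. v b)"
        unfolding F_def by (simp add: sum.Sigma)
      also have "\<dots> = (\<Sum>b\<in>F. ennreal (v b))" using v by (simp add: sum_ennreal)
      also have "\<dots> = (\<integral>\<^sup>+b. ennreal (v b) * indicator F b \<partial>count_space boxes)"
        using F by (subst nn_integral_count_space'[where A = F]) (auto simp: indicator_def)
      also have "\<dots> \<le> (\<integral>\<^sup>+b. ennreal (v b) \<partial>count_space boxes)"
        by (intro nn_integral_mono) (auto simp: indicator_def)
      finally show "(\<Sum>n<m. \<Sum>k<2 ^ n. v (n, k)) \<le> x" using x by (simp add: ennreal_le_iff)
    qed
    with div show False by blast
  qed
qed

lemma dyadic_sum_atomic_measure: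
  assumes "\<And>b. 0 \<le> v b"
  shows "dyadic_sum (atomic_measure v) \<gamma> = (\<Sum>n. ennreal (\<Sum>k<2 ^ n. v (n, k) powr \<gamma>))"
  unfolding dyadic_sum_def
proof (rule suminf_cong)
  fix n
  have "(\<Sum>k<2 ^ n. ennreal (measure (atomic_measure v) (dyadic_box n k) powr \<gamma>)) =
      (\<Sum>k<2 ^ n. ennreal (v (n, k) powr \<gamma>))"
    using assms by (intro sum.cong refl) (simp add: measure_atomic_measure_dyadic_box boxes_def)
  then show "(\<Sum>k<2 ^ n. ennreal (measure (atomic_measure v) (dyadic_box n k) powr \<gamma>)) =
      ennreal (\<Sum>k<2 ^ n. v (n, k) powr \<gamma>)" by (simp add: sum_ennreal)
qed

lemma not_summable_shifted_harmonic: "\<not> summable (\<lambda>n. 1 / real (n + 1))"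
  using not_summable_harmonic[where 'a = real] summable_Suc_iff[of "\<lambda>n. 1 / real n"]
  by (simp add: inverse_eq_divide)

lemma summable_shifted_powr: "s < - 1 \<Longrightarrow> summable (\<lambda>n. real (n + 1) powr s)"
  using summable_Suc_iff[of "\<lambda>n. real n powr s"] summable_real_powr_iff[of s] by simp

lemma not_summable_shifted_powr: "- 1 \<le> s \<Longrightarrow> \<not> summable (\<lambda>n. real (n + 1) powr s)"
  using summable_Suc_iff[of "\<lambda>n. real n powr s"] summable_real_powr_iff[of s] by simp

section \<open>Almost sure divergence when the weighted mean is infinite\<close>

context poisson_process
begin

text \<open>The lower-tail bound exp (C - s / 2), with s the mean over the first generations, tends
  to 0 for each fixed C.\<close>

lemma AE_wsum_unbounded:
  assumes c: "\<And>b. 0 \<le> c b" "\<And>b. c b \<le> 1" and div: "\<not> summable (\<lambda>n. \<Sum>k<2 ^ n. c (n, k) * w (n, k))"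
  shows "AE \<omega> in M. \<forall>C::nat. \<exists>L. real C < wsum c (levels L) \<omega>"
  unfolding AE_all_countable
proof
  fix C :: nat
  define A where "A L = {\<omega> \<in> space M. wsum c (levels L) \<omega> \<le> ennreal (real C)}" for L
  have A: "A L \<in> events" for L
    unfolding A_def using levels_boxes by measurable
  define s where "s L = (\<Sum>b\<in>levels L. c b * w b)" for L
  have "prob (\<Inter>L. A L) \<le> 0"
  proof (rule LIMSEQ_le_const)
    have "filterlim (\<lambda>L. \<Sum>n\<in>{1..<L}. \<Sum>k<2 ^ n. c (n, k) * w (n, k)) at_top sequentially"
      using div c w_nonneg by (intro partial_sums_unbounded) (auto intro!: sum_nonneg)
    then have "filterlim s at_top sequentially" unfolding s_def sum_levels .
    then have "filterlim (\<lambda>L. - real C + (1 / 2) * s L) at_top sequentially"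
      by (intro filterlim_tendsto_add_at_top[OF tendsto_const] filterlim_tendsto_pos_mult_at_top[OF tendsto_const]) auto
    then have "filterlim (\<lambda>L. - (- real C + (1 / 2) * s L)) at_bot sequentially"
      by (simp only: filterlim_uminus_at_top)
    then show "(\<lambda>L. exp (- (- real C + (1 / 2) * s L))) \<longlonglongrightarrow> 0"
      by (rule filterlim_compose[OF exp_at_bot])
    have "prob (\<Inter>L. A L) \<le> exp (- (- real C + (1 / 2) * s L))" for L
    proof -
      have "prob (\<Inter>L. A L) \<le> prob (A L)" using A by (intro finite_measure_mono) auto
      also have "\<dots> \<le> exp (real C - s L / 2)"
        unfolding A_def s_def using c by (intro prob_wsum_le_le finite_levels levels_boxes) auto
      finally show ?thesis by simp
    qed
    then show "\<exists>N. \<forall>L\<ge>N. prob (\<Inter>L. A L) \<le> exp (- (- real C + (1 / 2) * s L))" by blast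
  qed
  then have "(\<Inter>L. A L) \<in> null_sets M" using A by (auto simp: emeasure_eq_measure measure_le_0_iff)
  then have "AE \<omega> in M. \<omega> \<notin> (\<Inter>L. A L)" by (rule AE_not_in)
  then show "AE \<omega> in M. \<exists>L. real C < wsum c (levels L) \<omega>"
    using AE_space by eventually_elim (auto simp: A_def not_le)
qed

text \<open>The full circle alone violates the condition: its Carleson box contains all boxes from
  generation 1 on, and their weighted count is almost surely unbounded.\<close>

lemma not_carleson_if_weighted_sum_infinite:
  assumes \<alpha>: "0 < \<alpha>" and div: "\<not> summable (\<lambda>n. (1 / 2 ^ n) powr \<alpha> * (\<Sum>k<2 ^ n. w (n, k)))"
  shows "carleson_with_prob M \<Lambda> \<alpha> 0"
proof (rule carleson_almost_never[OF \<alpha>])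
  define c where "c b = (1 / 2 ^ (fst b + 1)) powr \<alpha>" for b :: "nat \<times> nat"
  have "0 \<le> c b" for b by (simp add: c_def)
  moreover have "c b \<le> 1" for b
  proof -
    have "1 \<le> (2::real) ^ (fst b + 1)" by (rule one_le_power) simp
    then have "1 / 2 ^ (fst b + 1) \<le> (1::real)" by simp
    then show ?thesis unfolding c_def using \<alpha> powr_mono2[of \<alpha> "1 / 2 ^ (fst b + 1)" 1] by simp
  qed
  moreover have "\<not> summable (\<lambda>n. \<Sum>k<2 ^ n. c (n, k) * w (n, k))"
  proof -
    have c: "c (n, k) = (1 / 2) powr \<alpha> * (1 / 2 ^ n) powr \<alpha>" for n k
      by (simp add: c_def flip: powr_mult)
    have "(\<Sum>k<2 ^ n. c (n, k) * w (n, k)) = (1 / 2) powr \<alpha> * ((1 / 2 ^ n) powr \<alpha> * (\<Sum>k<2 ^ n. w (n, k)))" for n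
      by (simp only: c sum_distrib_left mult.assoc)
    then show ?thesis using div by (simp add: summable_cmult_iff)
  qed
  ultimately have "AE \<omega> in M. \<forall>C::nat. \<exists>L. real C < wsum c (levels L) \<omega>"
    by (rule AE_wsum_unbounded)
  then show "AE \<omega> in M. \<not> carleson_sequence \<alpha> (\<Lambda> \<omega>)"
  proof eventually_elim
    case (elim \<omega>)
    show ?case
    proof
      assume "carleson_sequence \<alpha> (\<Lambda> \<omega>)"
      then obtain C :: nat where C: "\<And>n k. k < 2 ^ n \<Longrightarrow>
          carleson_sum \<alpha> (carleson_box (dyadic_arc n k)) (\<Lambda> \<omega>) \<le> ennreal (real C * (1 / 2 ^ n) powr \<alpha>)"
        unfolding carleson_sequence_iff_dyadic[OF \<alpha>] by blast
      obtain L where L: "real C < wsum c (levels L) \<omega>" using elim by blast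
      have "wsum c (levels L) \<omega> \<le> carleson_sum \<alpha> (carleson_box (dyadic_arc 0 0)) (\<Lambda> \<omega>)"
        unfolding c_def
      proof (rule carleson_sum_ge[OF \<alpha> finite_levels levels_boxes])
        fix b assume b: "b \<in> levels L"
        show "tile b \<subseteq> carleson_box (dyadic_arc 0 0)"
        proof
          fix z assume z: "z \<in> tile b"
          have k: "snd b < 2 ^ fst b" and n: "1 \<le> fst b" using b by (auto simp: levels_def)
          have "norm z < 1" using z dyadic_box_subset_disk[OF k] by (auto simp: tile_def)
          moreover have "0 < norm z"
          proof -
            have "1 - norm z \<le> 1 / 2 ^ fst b" using z dyadic_box_iff[OF k] by (simp add: tile_def)
            also have "\<dots> < 1" using n by simp
            finally show ?thesis by simp
          qed
          moreover have "\<lfloor>turn z\<rfloor> = 0" using turn_nonneg turn_less_1 by (simp add: floor_eq_iff)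
          ultimately show "z \<in> carleson_box (dyadic_arc 0 0)" by (simp add: carleson_box_dyadic_iff)
        qed
      qed
      also have "\<dots> \<le> ennreal (real C)" using C[of 0 0] by simp
      finally show False using L by (simp add: not_less)
    qed
  qed
qed

end

section \<open>The two examples\<close>

lemma counterexample_carleson:
  assumes \<alpha>: "0 < \<alpha>" "\<alpha> < 1"
  shows "\<exists>\<mu>. intensity_measure \<mu> \<and> dyadic_sum \<mu> (1 / (1 - \<alpha>)) < \<infinity> \<and>
    (\<forall>(M :: 'w measure) \<Lambda>. poisson_point_process M \<mu> \<Lambda> \<longrightarrow> carleson_with_prob M \<Lambda> \<alpha> 0)"
proof -
  \<comment> \<open>To the power 1 / (1 - \<alpha>) the first factor becomes 1 / 2 ^ n and cancels
    the number of boxes, leaving a summable power of n + 1; in the weighted mean only 1 / (n + 1)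
    remains.\<close>
  define v where "v b = (1 / 2 ^ fst b) powr (1 - \<alpha>) / real (fst b + 1)" for b :: "nat \<times> nat"
  have v0: "0 \<le> v b" for b by (simp add: v_def)
  have level: "(1 / 2 ^ n) powr \<alpha> * (\<Sum>k<2 ^ n. v (n, k)) = 1 / real (n + 1)" for n
  proof -
    have "(1 / 2 ^ n) powr \<alpha> * (1 / 2 ^ n) powr (1 - \<alpha>) = (1 / 2 ^ n :: real)"
      by (simp flip: powr_add)
    then have "2 ^ n * ((1 / 2 ^ n) powr \<alpha> * (1 / 2 ^ n) powr (1 - \<alpha>)) = (1::real)" by simp
    then show ?thesis by (simp add: v_def mult_ac)
  qed
  have int: "intensity_measure (atomic_measure v)"
  proof (rule intensity_measure_atomic_measure[OF v0])
    show "\<not> summable (\<lambda>n. \<Sum>k<2 ^ n. v (n, k))"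
    proof
      assume s: "summable (\<lambda>n. \<Sum>k<2 ^ n. v (n, k))"
      have "summable (\<lambda>n. 1 / real (n + 1))"
      proof (rule summable_comparison_test'[OF s])
        fix n
        have "(1 / 2 ^ n) powr \<alpha> \<le> (1::real)" using \<alpha> powr_mono2[of \<alpha> "1 / 2 ^ n" 1] by simp
        then have "(1 / 2 ^ n) powr \<alpha> * (\<Sum>k<2 ^ n. v (n, k)) \<le> 1 * (\<Sum>k<2 ^ n. v (n, k))"
          by (intro mult_right_mono sum_nonneg v0)
        then show "norm (1 / real (n + 1)) \<le> (\<Sum>k<2 ^ n. v (n, k))" by (simp add: level)
      qed
      with not_summable_shifted_harmonic show False by blast
    qed
  qed
  have "dyadic_sum (atomic_measure v) (1 / (1 - \<alpha>)) < \<infinity>"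
  proof -
    have "(\<Sum>k<2 ^ n. v (n, k) powr (1 / (1 - \<alpha>))) = real (n + 1) powr (- (1 / (1 - \<alpha>)))" for n
    proof -
      have "v (n, k) powr (1 / (1 - \<alpha>)) = (1 / 2 ^ n) * real (n + 1) powr (- (1 / (1 - \<alpha>)))" for k
      proof -
        have "v (n, k) powr (1 / (1 - \<alpha>)) =
            (1 / 2 ^ n) powr ((1 - \<alpha>) * (1 / (1 - \<alpha>))) / real (n + 1) powr (1 / (1 - \<alpha>))"
          unfolding v_def fst_conv by (subst powr_divide) (simp only: powr_powr)
        also have "(1 - \<alpha>) * (1 / (1 - \<alpha>)) = 1" using \<alpha> by simp
        finally show ?thesis by (simp add: powr_minus_divide)
      qed
      then show ?thesis by simp
    qed
    moreover have "summable (\<lambda>n. real (n + 1) powr (- (1 / (1 - \<alpha>))))"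
      using \<alpha> by (intro summable_shifted_powr) (simp add: field_simps)
    ultimately show ?thesis
      unfolding dyadic_sum_atomic_measure[OF v0] by (simp only:) (subst suminf_ennreal_finite_iff, auto)
  qed
  moreover have "carleson_with_prob M \<Lambda> \<alpha> 0"
    if "poisson_point_process M (atomic_measure v) \<Lambda>" for M :: "'w measure" and \<Lambda>
  proof -
    interpret poisson_process M "atomic_measure v" \<Lambda> using int that by unfold_locales
    have w: "w (n, k) = v (n, k)" if "k < 2 ^ n" for n k
      using that by (simp add: w_def tile_def measure_atomic_measure_dyadic_box v0 boxes_def)
    show ?thesis
      using \<alpha> not_summable_shifted_harmonic
      by (intro not_carleson_if_weighted_sum_infinite) (simp_all add: w level del: of_nat_Suc of_nat_add)
  qed
  ultimately show ?thesis using int by blast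
qed

text \<open>With one charged box per generation the trees do not branch, so for every \<alpha> > 0
  the mean below (n, 0) is at most a constant times \<open>x n\<close>, without Hoelder's
  inequality.\<close>

lemma counterexample_dyadic_sum:
  assumes \<gamma>: "1 < \<gamma>"
  shows "\<exists>\<mu>. intensity_measure \<mu> \<and> dyadic_sum \<mu> \<gamma> = \<infinity> \<and>
    (\<forall>(M :: 'w measure) \<Lambda>. poisson_point_process M \<mu> \<Lambda> \<longrightarrow>
      (\<forall>\<alpha>. 0 < \<alpha> \<and> \<alpha> < 1 \<longrightarrow> carleson_with_prob M \<Lambda> \<alpha> 1))"
proof -
  \<comment> \<open>Its \<gamma>-th power is 1 / (n + 1), the borderline of divergence; as 1 /
    \<gamma> < 1, the total mass is infinite too.\<close>
  define x where "x n = real (n + 1) powr (- (1 / \<gamma>))" for n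
  define v where "v b = (if snd b = 0 then x (fst b) else 0)" for b :: "nat \<times> nat"
  have x0: "0 \<le> x n" for n by (simp add: x_def)
  have v0: "0 \<le> v b" for b by (simp add: v_def x0)
  have sum0: "(\<Sum>k<(2::nat) ^ n. if k = 0 then y else 0) = y" for n :: nat and y :: real
    by (subst sum.delta) auto
  have int: "intensity_measure (atomic_measure v)"
  proof (rule intensity_measure_atomic_measure[OF v0])
    have "\<not> summable x" unfolding x_def using \<gamma> by (intro not_summable_shifted_powr) (simp add: field_simps)
    then show "\<not> summable (\<lambda>n. \<Sum>k<2 ^ n. v (n, k))" by (simp add: v_def sum0)
  qed
  have "dyadic_sum (atomic_measure v) \<gamma> = \<infinity>"
  proof -
    have "(\<Sum>k<2 ^ n. v (n, k) powr \<gamma>) = real (n + 1) powr (- 1)" for n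
    proof -
      have "v (n, k) powr \<gamma> = (if k = 0 then real (n + 1) powr (- 1) else 0)" for k
        using \<gamma> by (simp add: v_def x_def powr_powr)
      then show ?thesis by (simp only: sum0)
    qed
    moreover have "\<not> (\<Sum>n. ennreal (real (n + 1) powr (- 1))) < \<infinity>"

      using not_summable_shifted_powr[of "- 1"] by (subst suminf_ennreal_finite_iff) (simp_all only: powr_ge_zero order_refl simp_thms)
    ultimately show ?thesis unfolding dyadic_sum_atomic_measure[OF v0] by (simp add: not_less top_unique)
  qed
  moreover have "carleson_with_prob M \<Lambda> \<alpha> 1"
    if P: "poisson_point_process M (atomic_measure v) \<Lambda>" and \<alpha>: "0 < \<alpha>" "\<alpha> < 1" for M :: "'w measure" and \<Lambda> \<alpha>
  proof -
    interpret poisson_process M "atomic_measure v" \<Lambda> using int P by unfold_locales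
    have w: "w b = v b" if "b \<in> boxes" for b
      using that by (cases b) (simp add: w_def tile_def measure_atomic_measure_dyadic_box v0)
    define \<rho> where "\<rho> = (2::real) powr - \<alpha>"
    have "2 powr - \<alpha> < (2::real) powr 0" using \<alpha> by (intro powr_less_mono) auto
    then have \<rho>: "0 \<le> \<rho>" "\<rho> < 1" by (auto simp: \<rho>_def)
    define \<epsilon> where "\<epsilon> n k = (if k = 0 then 1 / (1 - \<rho>) * x n else 0)" for n k :: nat
    show ?thesis
    \<comment> \<open>The threshold is free, and 2 \<gamma> turns \<open>x n\<close> into (n + 1)
      powr (- 2), which is summable.\<close>
    proof (rule carleson_almost_surely[where p = "2 * \<gamma>"])
      show "0 < \<alpha>" "0 < 2 * \<gamma>" using \<alpha> \<gamma> by auto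
      show "0 \<le> \<epsilon> n k" for n k using \<rho> by (simp add: \<epsilon>_def x0)
      show "(\<Sum>b\<in>subtree n k L. depth_weight \<alpha> n b * w b) \<le> \<epsilon> n k" if k: "k < 2 ^ n" for n k L
      proof -
        have "(\<Sum>b\<in>subtree n k L. depth_weight \<alpha> n b * w b) = (\<Sum>b\<in>subtree n k L. depth_weight \<alpha> n b * v b)"
        proof (intro sum.cong refl)
          fix b assume "b \<in> subtree n k L"
          then have "b \<in> boxes" using subtree_boxes[OF k] by blast
          then show "depth_weight \<alpha> n b * w b = depth_weight \<alpha> n b * v b" by (simp add: w)
        qed
        \<comment> \<open>\<open>k * 2 ^ l + i\<close> vanishes only for k = i = 0, so the tree
          below (n, k) meets charged boxes only if k = 0.\<close>
        also have "\<dots> = (\<Sum>l<L. \<Sum>i<(2::nat) ^ l. if i = 0 then (if k = 0 then \<rho> ^ l * x (n + l) else 0) else 0)"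
          unfolding sum_subtree
          by (intro sum.cong refl) (auto simp: v_def depth_weight_def inverse_power_powr \<rho>_def)
        also have "\<dots> \<le> (\<Sum>l<L. if k = 0 then \<rho> ^ l * x n else 0)"
        proof (unfold sum0, rule sum_mono)
          fix l
          have "x (n + l) \<le> x n" unfolding x_def using \<gamma> by (intro powr_mono2') auto
          then show "(if k = 0 then \<rho> ^ l * x (n + l) else 0) \<le> (if k = 0 then \<rho> ^ l * x n else 0)"
            using \<rho> by (simp add: mult_left_mono)
        qed
        also have "\<dots> \<le> \<epsilon> n k"
          using geometric_partial_le[OF \<rho>, of L] x0[of n]
          by (simp add: \<epsilon>_def sum_distrib_right[symmetric] mult_right_mono del: times_divide_eq_left)
        finally show ?thesis .
      qed
      have "(\<Sum>k<2 ^ n. \<epsilon> n k powr (2 * \<gamma>)) = (1 / (1 - \<rho>)) powr (2 * \<gamma>) * real (n + 1) powr (- 2)" for n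
      proof -
        have "\<epsilon> n k powr (2 * \<gamma>) = (if k = 0 then (1 / (1 - \<rho>)) powr (2 * \<gamma>) * real (n + 1) powr (- 2) else 0)" for k
        proof -
          have "(1 / (1 - \<rho>) * x n) powr (2 * \<gamma>) = (1 / (1 - \<rho>)) powr (2 * \<gamma>) * x n powr (2 * \<gamma>)"
            by (rule powr_mult)
          moreover have "x n powr (2 * \<gamma>) = real (n + 1) powr (- 2)"
            using \<gamma> by (simp add: x_def powr_powr)
          ultimately show ?thesis by (simp add: \<epsilon>_def del: times_divide_eq_left)
        qed
        then show ?thesis by (simp only: sum0)
      qed
      then show "summable (\<lambda>n. \<Sum>k<2 ^ n. \<epsilon> n k powr (2 * \<gamma>))"
        using summable_shifted_powr[of "-2"] by (simp only: summable_mult)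
    qed
  qed
  ultimately show ?thesis using int by blast
qed

theorem theorem1p4:
  shows
   "(\<forall>\<mu> (M :: 'w measure) \<Lambda>. intensity_measure \<mu> \<and> poisson_point_process M \<mu> \<Lambda> \<longrightarrow>
       ((\<exists>\<gamma>>1. dyadic_sum \<mu> \<gamma> < \<infinity>) \<longrightarrow> carleson_with_prob M \<Lambda> 1 1) \<and>
       ((\<forall>\<gamma>>1. dyadic_sum \<mu> \<gamma> = \<infinity>) \<longrightarrow> carleson_with_prob M \<Lambda> 1 0)) \<and>
    (\<forall>\<alpha> \<mu> (M :: 'w measure) \<Lambda>. 0 < \<alpha> \<and> \<alpha> < 1 \<and>
       intensity_measure \<mu> \<and> poisson_point_process M \<mu> \<Lambda> \<and>
       (\<exists>\<gamma>. 1 < \<gamma> \<and> \<gamma> < 1 / (1 - \<alpha>) \<and> dyadic_sum \<mu> \<gamma> < \<infinity>) \<longrightarrow>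
       carleson_with_prob M \<Lambda> \<alpha> 1) \<and>
    (\<forall>\<alpha>. 0 < \<alpha> \<and> \<alpha> < 1 \<longrightarrow>
       (\<exists>\<mu>. intensity_measure \<mu> \<and> dyadic_sum \<mu> (1 / (1 - \<alpha>)) < \<infinity> \<and>
          (\<forall>(M :: 'w measure) \<Lambda>. poisson_point_process M \<mu> \<Lambda> \<longrightarrow> carleson_with_prob M \<Lambda> \<alpha> 0))) \<and>
    (\<forall>\<gamma>>1.
       (\<exists>\<mu>. intensity_measure \<mu> \<and> dyadic_sum \<mu> \<gamma> = \<infinity> \<and>
          (\<forall>(M :: 'w measure) \<Lambda>. poisson_point_process M \<mu> \<Lambda> \<longrightarrow>
             (\<forall>\<alpha>. 0 < \<alpha> \<and> \<alpha> < 1 \<longrightarrow> carleson_with_prob M \<Lambda> \<alpha> 1))))"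
proof (intro conjI allI impI)
  fix \<mu> and M :: "'w measure" and \<Lambda>
  assume "intensity_measure \<mu> \<and> poisson_point_process M \<mu> \<Lambda>"
  then interpret poisson_process M \<mu> \<Lambda> by unfold_locales auto
  show "carleson_with_prob M \<Lambda> 1 1" if "\<exists>\<gamma>>1. dyadic_sum \<mu> \<gamma> < \<infinity>"
    \<comment> \<open>For \<alpha> = 1 the condition \<gamma> (1 - \<alpha>) < 1 reads 0 < 1, so
      every \<gamma> > 1 is admissible.\<close>
    using that by (auto intro!: carleson_if_dyadic_sum_finite)
  show "carleson_with_prob M \<Lambda> 1 0" if "\<forall>\<gamma>>1. dyadic_sum \<mu> \<gamma> = \<infinity>"
    using that by (intro not_carleson_if_dyadic_sum_infinite) auto
next
  fix \<alpha> \<mu> and M :: "'w measure" and \<Lambda>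
  assume *: "0 < \<alpha> \<and> \<alpha> < 1 \<and> intensity_measure \<mu> \<and> poisson_point_process M \<mu> \<Lambda> \<and>
       (\<exists>\<gamma>. 1 < \<gamma> \<and> \<gamma> < 1 / (1 - \<alpha>) \<and> dyadic_sum \<mu> \<gamma> < \<infinity>)"
  then interpret poisson_process M \<mu> \<Lambda> by unfold_locales auto
  from * obtain \<gamma> where "1 < \<gamma>" "\<gamma> < 1 / (1 - \<alpha>)" "dyadic_sum \<mu> \<gamma> < \<infinity>" by blast
  then show "carleson_with_prob M \<Lambda> \<alpha> 1"
    using * by (intro carleson_if_dyadic_sum_finite[of \<alpha> \<gamma>]) (auto simp: field_simps)
next
  fix \<alpha> :: real
  assume "0 < \<alpha> \<and> \<alpha> < 1"
  then show "\<exists>\<mu>. intensity_measure \<mu> \<and> dyadic_sum \<mu> (1 / (1 - \<alpha>)) < \<infinity> \<and>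
      (\<forall>(M :: 'w measure) \<Lambda>. poisson_point_process M \<mu> \<Lambda> \<longrightarrow> carleson_with_prob M \<Lambda> \<alpha> 0)"
    by (intro counterexample_carleson) auto
qed (rule counterexample_dyadic_sum)

end
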